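(* Let $[0,1]$ be equipped with Lebesgue measure, let $\Delta=\{(x,y)\in[0,1]\times[0,1]:x<y\}$ and let $\varphi=\chi_\Delta$ be its characteristic function. Then $\varphi$ is a closable multiplier but not a w*-closable multiplier on $[0,1]\times[0,1]$.
   Context: Let $H=L^2([0,1])$. For $k\in L^2([0,1]^2)$ let $I_k:H\to H$ be the Hilbert–Schmidt operator $(I_k\xi)(y)=\int_0^1k(x,y)\xi(x)\,dx$. For a measurable function $\varphi$ on $[0,1]^2$ let $D(\varphi)=\{k\in L^2([0,1]^2):\varphi k\in L^2([0,1]^2)\}$ and let $S_\varphi$ be the densely defined operator on the space $\mathcal{K}(H)$ of compact operators (operator norm) with domain $\{I_k:k\in D(\varphi)\}$ given by $S_\varphi(I_k)=I_{\varphi k}$. The function $\varphi$ is a closable multiplier if the norm closure of the graph of $S_\varphi$ in $\mathcal{K}(H)\oplus\mathcal{K}(H)$ is the graph of an operator; it is a w*-closable multiplier if the weak* closure of the graph of $S_\varphi$ in $\mathcal{K}(H)^{**}\oplus\mathcal{K}(H)^{**}=\mathcal{B}(H)\oplus\mathcal{B}(H)$ is the graph of an operator. (The map $S_{\chi_\Delta}$ is called the transformer of triangular truncation.) *)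

theory Defs
  imports "HOL-Analysis.Analysis"
begin

section \<open>Complex normed spaces\<close>

text \<open>The library only has real normed spaces; a complex one is a real one with a compatible
  complex scalar multiplication.\<close>

class complex_normed_vector = real_normed_vector +
  fixes scaleC :: "complex \<Rightarrow> 'a \<Rightarrow> 'a" (infixr \<open>*\<^sub>C\<close> 75)
  assumes scaleC_add_right: "c *\<^sub>C (x + y) = c *\<^sub>C x + c *\<^sub>C y"
    and scaleC_add_left: "(c + d) *\<^sub>C x = c *\<^sub>C x + d *\<^sub>C x"
    and scaleC_scaleC: "c *\<^sub>C d *\<^sub>C x = (c * d) *\<^sub>C x"
    and scaleC_of_real: "of_real r *\<^sub>C x = r *\<^sub>R x"
    and norm_scaleC: "norm (c *\<^sub>C x) = norm c * norm x"

lemma bounded_linear_scaleC: "bounded_linear (\<lambda>x::'a::complex_normed_vector. c *\<^sub>C x)"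
proof (rule bounded_linear_intro[where K = "norm c"])
  fix r :: real and x :: 'a
  have "c *\<^sub>C r *\<^sub>R x = (c * of_real r) *\<^sub>C x"
    by (metis scaleC_of_real scaleC_scaleC)
  also have "\<dots> = r *\<^sub>R c *\<^sub>C x"
    by (metis mult.commute scaleC_of_real scaleC_scaleC)
  finally show "c *\<^sub>C r *\<^sub>R x = r *\<^sub>R c *\<^sub>C x" .
qed (auto simp: scaleC_add_right norm_scaleC mult.commute)

instantiation blinfun :: (real_normed_vector, complex_normed_vector) complex_normed_vector
begin

lift_definition scaleC_blinfun :: "complex \<Rightarrow> 'a \<Rightarrow>\<^sub>L 'b \<Rightarrow> 'a \<Rightarrow>\<^sub>L 'b" is "\<lambda>c T x. c *\<^sub>C T x"
  by (rule bounded_linear_compose[OF bounded_linear_scaleC])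

instance
proof
  fix c d :: complex and r :: real and S T :: "'a \<Rightarrow>\<^sub>L 'b"
  show "c *\<^sub>C (S + T) = c *\<^sub>C S + c *\<^sub>C T" by transfer (simp add: scaleC_add_right)
  show "(c + d) *\<^sub>C T = c *\<^sub>C T + d *\<^sub>C T" by transfer (simp add: scaleC_add_left)
  show assoc: "c *\<^sub>C d *\<^sub>C T = (c * d) *\<^sub>C T" for c d and T :: "'a \<Rightarrow>\<^sub>L 'b"
    by transfer (simp add: scaleC_scaleC)
  show of_real: "of_real r *\<^sub>C T = r *\<^sub>R T" for r and T :: "'a \<Rightarrow>\<^sub>L 'b"
    by transfer (simp add: scaleC_of_real)
  have le: "norm (c *\<^sub>C T) \<le> norm c * norm T" for c :: complex and T :: "'a \<Rightarrow>\<^sub>L 'b"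
  proof (rule norm_blinfun_bound)
    fix x
    have "norm (blinfun_apply (c *\<^sub>C T) x) = norm c * norm (blinfun_apply T x)"
      by (simp add: scaleC_blinfun.rep_eq norm_scaleC)
    also have "\<dots> \<le> norm c * (norm T * norm x)"
      by (intro mult_left_mono norm_blinfun) auto
    finally show "norm (blinfun_apply (c *\<^sub>C T) x) \<le> norm c * norm T * norm x"
      by (simp add: mult.assoc)
  qed auto
  show "norm (c *\<^sub>C T) = norm c * norm T"
  proof (cases "c = 0")
    case True
    then show ?thesis using le[of 0 T] by (simp add: order.antisym)
  next
    case False
    have "T = 1 *\<^sub>C T"
      using of_real[of 1 T] by simp
    then have "T = inverse c *\<^sub>C c *\<^sub>C T"
      using False assoc[of "inverse c" c T] by simp
    then have "norm T \<le> norm (inverse c) * norm (c *\<^sub>C T)"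
      by (metis le)
    then have "norm c * norm T \<le> norm (c *\<^sub>C T)"
      using False by (simp add: norm_inverse norm_divide field_simps)
    then show ?thesis using le[of c T] by simp
  qed
qed

end


section \<open>The Hilbert space of square integrable functions on the unit interval\<close>

text \<open>Working with Borel representatives is no restriction: every Lebesgue measurable function
  is almost everywhere equal to a Borel one, on \<open>[0,1]\<close> and on \<open>[0,1] \<times> [0,1]\<close>.\<close>

abbreviation unit_measure :: "real measure"
  where "unit_measure \<equiv> restrict_space lborel {0..1}"

abbreviation square_measure :: "(real \<times> real) measure"
  where "square_measure \<equiv> unit_measure \<Otimes>\<^sub>M unit_measure"

definition square_integrable :: "'a measure \<Rightarrow> ('a \<Rightarrow> complex) \<Rightarrow> bool"
  where "square_integrable M f \<longleftrightarrow> f \<in> borel_measurable M \<and> integrable M (\<lambda>x. (norm (f x))\<^sup>2)"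

lemma square_integrable_measurable: "square_integrable M f \<Longrightarrow> f \<in> borel_measurable M"
  by (simp add: square_integrable_def)

lemma square_integrable_zero: "square_integrable M (\<lambda>x. 0)"
  by (simp add: square_integrable_def)

lemma square_integrable_cmult:
  "square_integrable M f \<Longrightarrow> square_integrable M (\<lambda>x. c * f x)"
  by (auto simp: square_integrable_def norm_mult power_mult_distrib)

lemma square_integrable_add:
  assumes "square_integrable M f" "square_integrable M g"
  shows "square_integrable M (\<lambda>x. f x + g x)"
  unfolding square_integrable_def
proof
  have [measurable]: "f \<in> borel_measurable M" "g \<in> borel_measurable M"
    using assms by (auto simp: square_integrable_def)
  show "(\<lambda>x. f x + g x) \<in> borel_measurable M" by measurable
  show "integrable M (\<lambda>x. (norm (f x + g x))\<^sup>2)"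
  proof (rule Bochner_Integration.integrable_bound)
    show "integrable M (\<lambda>x. 2 * (norm (f x))\<^sup>2 + 2 * (norm (g x))\<^sup>2)"
      using assms by (auto simp: square_integrable_def)
    show "AE x in M. norm ((norm (f x + g x))\<^sup>2) \<le> norm (2 * (norm (f x))\<^sup>2 + 2 * (norm (g x))\<^sup>2)"
    proof (rule AE_I2)
      fix x
      have "(norm (f x + g x))\<^sup>2 \<le> (norm (f x) + norm (g x))\<^sup>2"
        by (intro power_mono norm_triangle_ineq) auto
      also have "\<dots> \<le> 2 * (norm (f x))\<^sup>2 + 2 * (norm (g x))\<^sup>2"
        using zero_le_power2[of "norm (f x) - norm (g x)"]
        by (simp add: power2_eq_square algebra_simps)
      finally show "norm ((norm (f x + g x))\<^sup>2) \<le> norm (2 * (norm (f x))\<^sup>2 + 2 * (norm (g x))\<^sup>2)"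
        by simp
    qed
  qed measurable
qed

lemma square_integrable_mult:
  assumes "square_integrable M f" "square_integrable M g"
  shows "integrable M (\<lambda>x. norm (f x) * norm (g x))"
proof (rule Bochner_Integration.integrable_bound)
  have [measurable]: "f \<in> borel_measurable M" "g \<in> borel_measurable M"
    using assms by (auto simp: square_integrable_def)
  show "integrable M (\<lambda>x. (norm (f x))\<^sup>2 + (norm (g x))\<^sup>2)"
    using assms by (auto simp: square_integrable_def)
  show "(\<lambda>x. norm (f x) * norm (g x)) \<in> borel_measurable M" by measurable
  show "AE x in M. norm (norm (f x) * norm (g x)) \<le> norm ((norm (f x))\<^sup>2 + (norm (g x))\<^sup>2)"
  proof (rule AE_I2)
    fix x
    have "2 * (norm (f x) * norm (g x)) \<le> (norm (f x))\<^sup>2 + (norm (g x))\<^sup>2"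
      using zero_le_power2[of "norm (f x) - norm (g x)"]
      by (simp add: power2_eq_square algebra_simps)
    moreover have "0 \<le> norm (f x) * norm (g x)" by simp
    ultimately have "norm (f x) * norm (g x) \<le> (norm (f x))\<^sup>2 + (norm (g x))\<^sup>2"
      by linarith
    then show "norm (norm (f x) * norm (g x)) \<le> norm ((norm (f x))\<^sup>2 + (norm (g x))\<^sup>2)"
      by simp
  qed
qed

lemma square_integrable_inner:
  assumes "square_integrable M f" "square_integrable M g"
  shows "integrable M (\<lambda>x. inner (f x) (g x))"
proof (rule Bochner_Integration.integrable_bound[OF square_integrable_mult[OF assms]])
  have [measurable]: "f \<in> borel_measurable M" "g \<in> borel_measurable M"
    using assms by (auto simp: square_integrable_def)
  show "(\<lambda>x. inner (f x) (g x)) \<in> borel_measurable M" by measurable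
qed (auto simp: Cauchy_Schwarz_ineq2 abs_mult intro!: AE_I2)

definition L2_rel :: "(real \<Rightarrow> complex) \<Rightarrow> (real \<Rightarrow> complex) \<Rightarrow> bool"
  where "L2_rel f g \<longleftrightarrow> square_integrable unit_measure f \<and> square_integrable unit_measure g \<and>
    (AE x in unit_measure. f x = g x)"

quotient_type L2 = "real \<Rightarrow> complex" / partial: L2_rel
proof (rule part_equivpI)
  show "\<exists>f. L2_rel f f"
    by (auto simp: L2_rel_def intro: square_integrable_zero)
  show "symp L2_rel"
    by (auto simp: L2_rel_def symp_def)
  show "transp L2_rel"
    unfolding transp_def L2_rel_def by (auto elim: AE_mp)
qed

lemma L2_rel_rep: "L2_rel (rep_L2 f) (rep_L2 f)"
  using Quotient3_L2 Quotient3_rep_reflp by fastforce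

lemma square_integrable_rep: "square_integrable unit_measure (rep_L2 f)"
  using L2_rel_rep by (simp add: L2_rel_def)

lemma AE_rep_abs:
  assumes "square_integrable unit_measure f"
  shows "AE x in unit_measure. rep_L2 (abs_L2 f) x = f x"
  using assms rep_abs_rsp_left[OF Quotient3_L2, of f f]
  by (auto simp: L2_rel_def)

lemma L2_eqI:
  assumes "AE x in unit_measure. rep_L2 f x = rep_L2 g x"
  shows "f = g"
  using assms square_integrable_rep Quotient3_rel_rep[OF Quotient3_L2, of f g]
  by (auto simp: L2_rel_def)

instantiation L2 :: real_inner
begin

lift_definition zero_L2 :: L2 is "\<lambda>x. 0"
  by (auto simp: L2_rel_def square_integrable_zero)

lift_definition plus_L2 :: "L2 \<Rightarrow> L2 \<Rightarrow> L2" is "\<lambda>f g x. f x + g x"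
  by (auto simp: L2_rel_def square_integrable_add)

lift_definition uminus_L2 :: "L2 \<Rightarrow> L2" is "\<lambda>f x. - f x"
  using square_integrable_cmult[of _ _ "-1"] by (auto simp: L2_rel_def)

definition minus_L2 :: "L2 \<Rightarrow> L2 \<Rightarrow> L2" where "minus_L2 f g = f + - g"

lift_definition scaleR_L2 :: "real \<Rightarrow> L2 \<Rightarrow> L2" is "\<lambda>r f x. of_real r * f x"
  by (auto simp: L2_rel_def square_integrable_cmult)

lift_definition norm_L2 :: "L2 \<Rightarrow> real" is "\<lambda>f. sqrt (\<integral>x. (norm (f x))\<^sup>2 \<partial>unit_measure)"
  by (auto simp: L2_rel_def dest!: square_integrable_measurable intro!: integral_cong_AE)

lift_definition inner_L2 :: "L2 \<Rightarrow> L2 \<Rightarrow> real" is "\<lambda>f g. \<integral>x. inner (f x) (g x) \<partial>unit_measure"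
  by (auto simp: L2_rel_def dest!: square_integrable_measurable intro!: integral_cong_AE)

definition dist_L2 :: "L2 \<Rightarrow> L2 \<Rightarrow> real" where "dist_L2 f g = norm (f - g)"

definition sgn_L2 :: "L2 \<Rightarrow> L2" where "sgn_L2 f = inverse (norm f) *\<^sub>R f"

definition uniformity_L2 :: "(L2 \<times> L2) filter"
  where "uniformity_L2 = (INF e\<in>{0<..}. principal {(f, g). dist f g < e})"

definition open_L2 :: "L2 set \<Rightarrow> bool"
  where "open_L2 U \<longleftrightarrow> (\<forall>f\<in>U. \<forall>\<^sub>F (f', g) in uniformity. f' = f \<longrightarrow> g \<in> U)"

instance
proof
  fix f g h :: L2 and r s :: real and U :: "L2 set"
  show "f + g + h = f + (g + h)" 
    by transfer (auto simp: L2_rel_def square_integrable_add add.assoc)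
  show "f + g = g + f"
    by transfer (auto simp: L2_rel_def square_integrable_add add.commute)
  show "0 + f = f"
    by transfer (auto simp: L2_rel_def)
  show "- f + f = 0"
    by transfer (auto simp: L2_rel_def square_integrable_zero)
  show "f - g = f + - g" by (fact minus_L2_def)
  show "r *\<^sub>R (f + g) = r *\<^sub>R f + r *\<^sub>R g"
    by transfer (auto simp: L2_rel_def distrib_left distrib_right mult.assoc intro!: square_integrable_add square_integrable_cmult)
  show "(r + s) *\<^sub>R f = r *\<^sub>R f + s *\<^sub>R f"
    by transfer (auto simp: L2_rel_def distrib_left distrib_right mult.assoc intro!: square_integrable_add square_integrable_cmult)
  show "r *\<^sub>R s *\<^sub>R f = (r * s) *\<^sub>R f"
    by transfer (auto simp: L2_rel_def distrib_left distrib_right mult.assoc intro!: square_integrable_cmult)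
  show "1 *\<^sub>R f = f"
    by transfer (auto simp: L2_rel_def)
  show "sgn f = inverse (norm f) *\<^sub>R f" by (fact sgn_L2_def)
  show "dist f g = norm (f - g)" by (fact dist_L2_def)
  show "(uniformity :: (L2 \<times> L2) filter) = (INF e\<in>{0<..}. principal {(f, g). dist f g < e})"
    by (fact uniformity_L2_def)
  show "open U \<longleftrightarrow> (\<forall>f\<in>U. \<forall>\<^sub>F (f', g) in uniformity. f' = f \<longrightarrow> g \<in> U)"
    by (fact open_L2_def)
  show "inner f g = inner g f"
    by transfer (auto simp: inner_commute)
  show "inner (f + g) h = inner f h + inner g h"
    by transfer (auto simp: inner_add_left L2_rel_def square_integrable_inner)
  show "inner (r *\<^sub>R f) g = r * inner f g"
    by transfer (simp flip: scaleR_conv_of_real)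
  show "0 \<le> inner f f"
    by transfer auto
  show "inner f f = 0 \<longleftrightarrow> f = 0"
  proof transfer
    fix f :: "real \<Rightarrow> complex"
    assume f: "L2_rel f f"
    then have "(\<integral>x. inner (f x) (f x) \<partial>unit_measure) = 0 \<longleftrightarrow>
        (AE x in unit_measure. inner (f x) (f x) = 0)"
      by (intro integral_nonneg_eq_0_iff_AE) (auto simp: L2_rel_def square_integrable_inner)
    then show "(\<integral>x. inner (f x) (f x) \<partial>unit_measure) = 0 \<longleftrightarrow> L2_rel f (\<lambda>x. 0)"
      using f by (auto simp: L2_rel_def square_integrable_zero)
  qed
  show "norm f = sqrt (inner f f)"
    by transfer (simp add: power2_norm_eq_inner)
qed

end

instantiation L2 :: complex_normed_vector
begin

lift_definition scaleC_L2 :: "complex \<Rightarrow> L2 \<Rightarrow> L2" is "\<lambda>c f x. c * f x"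
  by (auto simp: L2_rel_def square_integrable_cmult)

instance
proof
  fix f g :: L2 and c d :: complex and r :: real
  show "c *\<^sub>C (f + g) = c *\<^sub>C f + c *\<^sub>C g"
    by transfer (auto simp: L2_rel_def distrib_left distrib_right mult.assoc intro!: square_integrable_add square_integrable_cmult)
  show "(c + d) *\<^sub>C f = c *\<^sub>C f + d *\<^sub>C f"
    by transfer (auto simp: L2_rel_def distrib_left distrib_right mult.assoc intro!: square_integrable_add square_integrable_cmult)
  show "c *\<^sub>C d *\<^sub>C f = (c * d) *\<^sub>C f"
    by transfer (auto simp: L2_rel_def distrib_left distrib_right mult.assoc intro!: square_integrable_cmult)
  show "of_real r *\<^sub>C f = r *\<^sub>R f"
    by transfer (auto simp: L2_rel_def intro!: square_integrable_cmult)
  show "norm (c *\<^sub>C f) = norm c * norm f"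
    by transfer (simp add: norm_mult power_mult_distrib real_sqrt_mult)
qed

end


section \<open>Duals, and closability of a graph\<close>

text \<open>In this section \<open>X\<close> is always a complex linear subspace of the ambient type. Functionals on
  \<open>X\<close> are made unique by being \<open>undefined\<close> outside \<open>X\<close>, as in \<open>extensional\<close>.\<close>

definition dual :: "'a::complex_normed_vector set \<Rightarrow> ('a \<Rightarrow> complex) set"
  where "dual X = {f \<in> extensional X.
    (\<forall>x\<in>X. \<forall>y\<in>X. f (x + y) = f x + f y) \<and>
    (\<forall>c. \<forall>x\<in>X. f (c *\<^sub>C x) = c * f x) \<and>
    (\<exists>B. \<forall>x\<in>X. norm (f x) \<le> B * norm x)}"

definition dual_norm :: "'a::complex_normed_vector set \<Rightarrow> ('a \<Rightarrow> complex) \<Rightarrow> real"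
  where "dual_norm X f = (SUP x \<in> {x \<in> X. norm x \<le> 1}. norm (f x))"

definition bidual :: "'a::complex_normed_vector set \<Rightarrow> (('a \<Rightarrow> complex) \<Rightarrow> complex) set"
  where "bidual X = {F \<in> extensional (dual X).
    (\<forall>f\<in>dual X. \<forall>g\<in>dual X. F (\<lambda>x\<in>X. f x + g x) = F f + F g) \<and>
    (\<forall>c. \<forall>f\<in>dual X. F (\<lambda>x\<in>X. c * f x) = c * F f) \<and>
    (\<exists>B. \<forall>f\<in>dual X. norm (F f) \<le> B * dual_norm X f)}"

definition bidual_embedding ::
    "'a::complex_normed_vector set \<Rightarrow> 'a \<Rightarrow> (('a \<Rightarrow> complex) \<Rightarrow> complex)"
  where "bidual_embedding X x = (\<lambda>f\<in>dual X. f x)"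

definition weak_star_topology ::
    "'a::complex_normed_vector set \<Rightarrow> (('a \<Rightarrow> complex) \<Rightarrow> complex) topology"
  where "weak_star_topology X = subtopology (product_topology (\<lambda>_. euclidean) (dual X)) (bidual X)"

text \<open>The closure of a linear graph is again a linear subspace, so it is the graph of a (linear)
  operator as soon as it is single-valued.\<close>

definition closable :: "'a::complex_normed_vector set \<Rightarrow> ('a \<times> 'a) set \<Rightarrow> bool"
  where "closable X G \<longleftrightarrow> single_valued (top_of_set (X \<times> X) closure_of G)"

definition weak_star_closable :: "'a::complex_normed_vector set \<Rightarrow> ('a \<times> 'a) set \<Rightarrow> bool"
  where "weak_star_closable X G \<longleftrightarrow>
    single_valued (prod_topology (weak_star_topology X) (weak_star_topology X) closure_of
      (map_prod (bidual_embedding X) (bidual_embedding X) ` G))"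


section \<open>Compact operators and closable multipliers\<close>

definition compact_operators :: "(L2 \<Rightarrow>\<^sub>L L2) set"
  where "compact_operators = {T :: L2 \<Rightarrow>\<^sub>L L2.
    (\<forall>c f. blinfun_apply T (c *\<^sub>C f) = c *\<^sub>C blinfun_apply T f) \<and>
    compact (closure (blinfun_apply T ` cball 0 1))}"

definition integral_transform :: "(real \<times> real \<Rightarrow> complex) \<Rightarrow> L2 \<Rightarrow> L2"
  where "integral_transform k f = abs_L2 (\<lambda>y. \<integral>x. k (x, y) * rep_L2 f x \<partial>unit_measure)"

lemma AE_square_measure_snd:
  assumes "square_integrable square_measure k"
  shows "AE y in unit_measure. square_integrable unit_measure (\<lambda>x. k (x, y))"
    and "integrable unit_measure (\<lambda>y. \<integral>x. (norm (k (x, y)))\<^sup>2 \<partial>unit_measure)"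
proof -
  interpret pair_sigma_finite unit_measure unit_measure
    by (simp add: pair_sigma_finite_def finite_measure.axioms finite_measure_restrict_space
        finite_measureI emeasure_restrict_space)
  have int: "integrable square_measure (\<lambda>(x, y). (norm (k (x, y)))\<^sup>2)"
    using assms by (simp add: square_integrable_def split_beta')
  have meas: "(\<lambda>x. k (x, y)) \<in> borel_measurable unit_measure" if "y \<in> space unit_measure" for y
    using measurable_compose[OF measurable_Pair2'[OF that] square_integrable_measurable[OF assms]] 
    by simp
  show "AE y in unit_measure. square_integrable unit_measure (\<lambda>x. k (x, y))"
    using AE_integrable_snd[OF int] AE_space
    by eventually_elim (simp add: square_integrable_def meas)
  show "integrable unit_measure (\<lambda>y. \<integral>x. (norm (k (x, y)))\<^sup>2 \<partial>unit_measure)"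
    using integrable_snd[OF int] .
qed

lemma HS_pointwise:
  assumes k: "square_integrable unit_measure k" and f: "square_integrable unit_measure f"
  shows "integrable unit_measure (\<lambda>x. k x * f x)"
    and "(norm (\<integral>x. k x * f x \<partial>unit_measure))\<^sup>2 \<le>
      (\<integral>x. (norm (k x))\<^sup>2 \<partial>unit_measure) * (\<integral>x. (norm (f x))\<^sup>2 \<partial>unit_measure)"
proof -
  have [measurable]: "k \<in> borel_measurable unit_measure" "f \<in> borel_measurable unit_measure"
    using k f by (auto simp: square_integrable_def)
  show int: "integrable unit_measure (\<lambda>x. k x * f x)"
    by (rule Bochner_Integration.integrable_bound[OF square_integrable_mult[OF k f]])
      (auto simp: norm_mult)
  define K where "K x = complex_of_real (norm (k x))" for x
  define F where "F x = complex_of_real (norm (f x))" for x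
  have KF: "square_integrable unit_measure K" "square_integrable unit_measure F"
    using k f unfolding square_integrable_def K_def F_def by auto
  have "L2_rel K K" "L2_rel F F"
    using KF by (auto simp: L2_rel_def)
  note simps = inner_L2.abs_eq[OF this(1) this(2)] inner_L2.abs_eq[OF this(1) this(1)]
    inner_L2.abs_eq[OF this(2) this(2)]
  have "norm (\<integral>x. k x * f x \<partial>unit_measure) \<le> (\<integral>x. norm (k x * f x) \<partial>unit_measure)"
    by (rule integral_norm_bound)
  also have "\<dots> = inner (abs_L2 K) (abs_L2 F)"
    by (simp add: simps K_def F_def norm_mult inner_complex_def)
  finally have "(norm (\<integral>x. k x * f x \<partial>unit_measure))\<^sup>2 \<le> (inner (abs_L2 K) (abs_L2 F))\<^sup>2"
    by (intro power_mono) auto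
  also have "\<dots> \<le> inner (abs_L2 K) (abs_L2 K) * inner (abs_L2 F) (abs_L2 F)"
    by (rule Cauchy_Schwarz_ineq)
  also have "\<dots> = (\<integral>x. (norm (k x))\<^sup>2 \<partial>unit_measure) * (\<integral>x. (norm (f x))\<^sup>2 \<partial>unit_measure)"
    by (simp add: simps K_def F_def inner_complex_def power2_eq_square)
  finally show "(norm (\<integral>x. k x * f x \<partial>unit_measure))\<^sup>2 \<le>
      (\<integral>x. (norm (k x))\<^sup>2 \<partial>unit_measure) * (\<integral>x. (norm (f x))\<^sup>2 \<partial>unit_measure)" .
qed

lemma HS_square_integrable:
  assumes k: "square_integrable square_measure k" and f: "square_integrable unit_measure f"
  shows "square_integrable unit_measure (\<lambda>y. \<integral>x. k (x, y) * f x \<partial>unit_measure)"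
    and "(\<integral>y. (norm (\<integral>x. k (x, y) * f x \<partial>unit_measure))\<^sup>2 \<partial>unit_measure) \<le>
      (\<integral>y. (\<integral>x. (norm (k (x, y)))\<^sup>2 \<partial>unit_measure) \<partial>unit_measure) *
      (\<integral>x. (norm (f x))\<^sup>2 \<partial>unit_measure)"
proof -
  interpret sigma_finite_measure unit_measure
    by (simp add: finite_measure.axioms finite_measureI emeasure_restrict_space)
  have [measurable]: "k \<in> borel_measurable square_measure" "f \<in> borel_measurable unit_measure"
    using k f by (auto simp: square_integrable_def)
  have meas [measurable]:
    "(\<lambda>y. \<integral>x. k (x, y) * f x \<partial>unit_measure) \<in> borel_measurable unit_measure"
    by measurable
  have bound: "AE y in unit_measure. (norm (\<integral>x. k (x, y) * f x \<partial>unit_measure))\<^sup>2 \<le>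
      (\<integral>x. (norm (k (x, y)))\<^sup>2 \<partial>unit_measure) * (\<integral>x. (norm (f x))\<^sup>2 \<partial>unit_measure)"
    using AE_square_measure_snd(1)[OF k] by eventually_elim (rule HS_pointwise(2)[OF _ f])
  have int: "integrable unit_measure (\<lambda>y. (\<integral>x. (norm (k (x, y)))\<^sup>2 \<partial>unit_measure) *
      (\<integral>x. (norm (f x))\<^sup>2 \<partial>unit_measure))"
    using AE_square_measure_snd(2)[OF k] by simp
  have int': "integrable unit_measure (\<lambda>y. (norm (\<integral>x. k (x, y) * f x \<partial>unit_measure))\<^sup>2)"
    by (rule Bochner_Integration.integrable_bound[OF int]) (use bound in \<open>auto elim: eventually_mono\<close>)
  show "square_integrable unit_measure (\<lambda>y. \<integral>x. k (x, y) * f x \<partial>unit_measure)"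
    using int' meas by (simp add: square_integrable_def)
  show "(\<integral>y. (norm (\<integral>x. k (x, y) * f x \<partial>unit_measure))\<^sup>2 \<partial>unit_measure) \<le>
      (\<integral>y. (\<integral>x. (norm (k (x, y)))\<^sup>2 \<partial>unit_measure) \<partial>unit_measure) *
      (\<integral>x. (norm (f x))\<^sup>2 \<partial>unit_measure)"
    using integral_mono_AE[OF int' int bound] by simp
qed

lemma AE_integral_transform:
  assumes "square_integrable square_measure k"
  shows "AE y in unit_measure. rep_L2 (integral_transform k f) y =
    (\<integral>x. k (x, y) * rep_L2 f x \<partial>unit_measure)"
  unfolding integral_transform_def
  by (intro AE_rep_abs HS_square_integrable(1) assms square_integrable_rep)

lemma norm_L2_rep: "norm f = sqrt (\<integral>x. (norm (rep_L2 f x))\<^sup>2 \<partial>unit_measure)"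
  by (simp add: norm_L2.rep_eq)

lemma AE_rep_add: "AE x in unit_measure. rep_L2 (f + g) x = rep_L2 f x + rep_L2 g x"
proof -
  have "f + g = abs_L2 (\<lambda>x. rep_L2 f x + rep_L2 g x)"
    using plus_L2.abs_eq[OF L2_rel_rep L2_rel_rep, of f g] Quotient3_abs_rep[OF Quotient3_L2] by simp
  then show ?thesis
    using AE_rep_abs[OF square_integrable_add[OF square_integrable_rep square_integrable_rep]] by simp
qed

lemma AE_rep_scaleC: "AE x in unit_measure. rep_L2 (c *\<^sub>C f) x = c * rep_L2 f x"
proof -
  have "c *\<^sub>C f = abs_L2 (\<lambda>x. c * rep_L2 f x)"
    using scaleC_L2.abs_eq[OF L2_rel_rep, of c f] Quotient3_abs_rep[OF Quotient3_L2] by simp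
  then show ?thesis
    using AE_rep_abs[OF square_integrable_cmult[OF square_integrable_rep]] by simp
qed

lemma integral_transform_add:
  assumes k: "square_integrable square_measure k"
  shows "integral_transform k (f + g) = integral_transform k f + integral_transform k g"
proof (rule L2_eqI)
  have [measurable]: "k \<in> borel_measurable square_measure" "rep_L2 h \<in> borel_measurable unit_measure" for h
    using k square_integrable_rep by (auto simp: square_integrable_def)
  show "AE y in unit_measure. rep_L2 (integral_transform k (f + g)) y =
      rep_L2 (integral_transform k f + integral_transform k g) y"
    using AE_integral_transform[OF k, of "f + g"] AE_integral_transform[OF k, of f]
      AE_integral_transform[OF k, of g] AE_rep_add[of "integral_transform k f" "integral_transform k g"]
      AE_square_measure_snd(1)[OF k]
  proof eventually_elim
    case (elim y)
    have "(\<integral>x. k (x, y) * rep_L2 (f + g) x \<partial>unit_measure) =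
        (\<integral>x. k (x, y) * rep_L2 f x + k (x, y) * rep_L2 g x \<partial>unit_measure)"
    proof (rule integral_cong_AE)
      have [measurable]: "(\<lambda>x. k (x, y)) \<in> borel_measurable unit_measure"
        using elim(5) by (simp add: square_integrable_def)
      show "(\<lambda>x. k (x, y) * rep_L2 (f + g) x) \<in> borel_measurable unit_measure" by measurable
      show "(\<lambda>x. k (x, y) * rep_L2 f x + k (x, y) * rep_L2 g x) \<in> borel_measurable unit_measure"
        by measurable
      show "AE x in unit_measure. k (x, y) * rep_L2 (f + g) x =
          k (x, y) * rep_L2 f x + k (x, y) * rep_L2 g x"
        using AE_rep_add[of f g] by eventually_elim (simp add: algebra_simps)
    qed
    also have "\<dots> = (\<integral>x. k (x, y) * rep_L2 f x \<partial>unit_measure) + (\<integral>x. k (x, y) * rep_L2 g x \<partial>unit_measure)"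
      by (intro Bochner_Integration.integral_add HS_pointwise(1) elim(5) square_integrable_rep)
    finally show ?case using elim(1-4) by simp
  qed
qed

lemma integral_transform_scaleC:
  assumes k: "square_integrable square_measure k"
  shows "integral_transform k (c *\<^sub>C f) = c *\<^sub>C integral_transform k f"
proof (rule L2_eqI)
  have [measurable]: "k \<in> borel_measurable square_measure" "rep_L2 h \<in> borel_measurable unit_measure" for h
    using k square_integrable_rep by (auto simp: square_integrable_def)
  show "AE y in unit_measure. rep_L2 (integral_transform k (c *\<^sub>C f)) y =
      rep_L2 (c *\<^sub>C integral_transform k f) y"
    using AE_integral_transform[OF k, of "c *\<^sub>C f"] AE_integral_transform[OF k, of f]
      AE_rep_scaleC[of c "integral_transform k f"] AE_square_measure_snd(1)[OF k]
  proof eventually_elim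
    case (elim y)
    have "(\<integral>x. k (x, y) * rep_L2 (c *\<^sub>C f) x \<partial>unit_measure) =
        (\<integral>x. c * (k (x, y) * rep_L2 f x) \<partial>unit_measure)"
    proof (rule integral_cong_AE)
      have [measurable]: "(\<lambda>x. k (x, y)) \<in> borel_measurable unit_measure"
        using elim(4) by (simp add: square_integrable_def)
      show "(\<lambda>x. k (x, y) * rep_L2 (c *\<^sub>C f) x) \<in> borel_measurable unit_measure" by measurable
      show "(\<lambda>x. c * (k (x, y) * rep_L2 f x)) \<in> borel_measurable unit_measure" by measurable
      show "AE x in unit_measure. k (x, y) * rep_L2 (c *\<^sub>C f) x = c * (k (x, y) * rep_L2 f x)"
        using AE_rep_scaleC[of c f] by eventually_elim (simp add: algebra_simps)
    qed
    then show ?case using elim(1-3) by simp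
  qed
qed

lemma norm_integral_transform:
  assumes k: "square_integrable square_measure k"
  shows "norm (integral_transform k f) \<le>
    norm f * sqrt (\<integral>y. (\<integral>x. (norm (k (x, y)))\<^sup>2 \<partial>unit_measure) \<partial>unit_measure)"
proof -
  have "norm (integral_transform k f) =
      sqrt (\<integral>y. (norm (\<integral>x. k (x, y) * rep_L2 f x \<partial>unit_measure))\<^sup>2 \<partial>unit_measure)"
    unfolding integral_transform_def
    using HS_square_integrable(1)[OF k square_integrable_rep]
    by (intro norm_L2.abs_eq) (simp add: L2_rel_def)
  also have "\<dots> \<le> sqrt ((\<integral>y. (\<integral>x. (norm (k (x, y)))\<^sup>2 \<partial>unit_measure) \<partial>unit_measure) *
      (\<integral>x. (norm (rep_L2 f x))\<^sup>2 \<partial>unit_measure))"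
    by (intro real_sqrt_le_mono HS_square_integrable(2) k square_integrable_rep)
  finally show ?thesis
    by (simp add: norm_L2_rep real_sqrt_mult mult.commute)
qed

lemma bounded_linear_integral_transform:
  assumes "square_integrable square_measure k"
  shows "bounded_linear (integral_transform k)"
  using integral_transform_add[OF assms] integral_transform_scaleC[OF assms, of "complex_of_real _"]
    norm_integral_transform[OF assms]
  by (intro bounded_linear_intro) (simp_all add: scaleC_of_real)

text \<open>\<open>Blinfun\<close> is meaningful only on bounded linear maps; for square integrable kernels the
  previous lemma applies.\<close>

definition HS_operator :: "(real \<times> real \<Rightarrow> complex) \<Rightarrow> L2 \<Rightarrow>\<^sub>L L2"
  where "HS_operator k = Blinfun (integral_transform k)"

lemma HS_operator_apply:
  assumes "square_integrable square_measure k"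
  shows "blinfun_apply (HS_operator k) f = integral_transform k f"
  using bounded_linear_integral_transform[OF assms]
  by (simp add: HS_operator_def bounded_linear_Blinfun_apply)

definition multiplier_domain :: "(real \<times> real \<Rightarrow> complex) \<Rightarrow> (real \<times> real \<Rightarrow> complex) set"
  where "multiplier_domain \<phi> = {k. square_integrable square_measure k \<and>
    square_integrable square_measure (\<lambda>p. \<phi> p * k p)}"

definition multiplier_graph ::
    "(real \<times> real \<Rightarrow> complex) \<Rightarrow> ((L2 \<Rightarrow>\<^sub>L L2) \<times> (L2 \<Rightarrow>\<^sub>L L2)) set"
  where "multiplier_graph \<phi> =
    {(HS_operator k, HS_operator (\<lambda>p. \<phi> p * k p)) | k. k \<in> multiplier_domain \<phi>}"

definition closable_multiplier :: "(real \<times> real \<Rightarrow> complex) \<Rightarrow> bool"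
  where "closable_multiplier \<phi> \<longleftrightarrow> closable compact_operators (multiplier_graph \<phi>)"

text \<open>The bidual of the compact operators is taken literally; it is canonically \<open>B(H)\<close>.\<close>

definition weak_star_closable_multiplier :: "(real \<times> real \<Rightarrow> complex) \<Rightarrow> bool"
  where "weak_star_closable_multiplier \<phi> \<longleftrightarrow>
    weak_star_closable compact_operators (multiplier_graph \<phi>)"

end

theory Submission
  imports Defs
begin

text \<open>Triangular truncation is the identity on kernels supported on rectangles
  \<open>{x < t} \<times> {y \<ge> t}\<close> and zero on kernels supported on rectangles \<open>{x \<ge> t} \<times> {y < t}\<close>, and these
  rectangles exhaust the square up to the diagonal.

  For norm closability, the rectangle conditions are inherited by norm limits
  (\<open>cutoff_triangular_truncation\<close>). Two limits over the same operator therefore differ by a compact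
  operator supported on the diagonal, that is, by one that commutes with the restriction of
  functions to intervals. It is a multiplication operator, and the measure has no atoms, so
  compactness forces it to vanish (\<open>compact_commuting_cutoff_eq_0\<close>).

  For weak* closability the diagonal can carry mass: the bidual contains all bounded multiplication
  operators. It is enough to find kernels \<open>k\<^sub>N\<close> whose operators tend to zero in norm while the
  truncated operators stay bounded and do not tend to zero weak* (\<open>not_weak_star_closableI\<close>; a weak*
  cluster point exists by the Banach--Alaoglu theorem). The classical candidate is the kernel of
  the Hilbert transform, cut off near the diagonal and divided by the logarithm of the cutoff. A
  dyadic model is easier to estimate. Let \<open>E\<^sub>j\<close> be the conditional expectation onto functions that are
  constant on dyadic intervals of length \<open>2\<^sup>-\<^sup>j\<close>, and let \<open>r\<^sub>j\<close> be the Rademacher function that is \<open>-1\<close>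
  on the left half and \<open>1\<close> on the right half of each of these intervals. For \<open>P = \<Sum> r\<^sub>j E\<^sub>j\<close>, summed
  over \<open>j < N\<close>, orthogonality of the Rademacher functions gives \<open>P\<^sup>* P = \<Sum> E\<^sub>j\<close> and thus
  \<open>\<parallel>P\<parallel> \<le> \<surd>N\<close> (\<open>norm_paraproduct_operator\<close>). The operator \<open>P - P\<^sup>*\<close> has an antisymmetric kernel that
  is positive at \<open>(x, y)\<close> if \<open>x\<close> lies in the left and \<open>y\<close> in the right half of a common dyadic
  interval, so triangular truncation retains its positive part
  (\<open>triangular_part_antisymmetric_kernel\<close>). The positive part has norm at most \<open>2 N\<close>
  by the Schur test (\<open>norm_triangular_operator\<close>) and integral \<open>N / 2\<close>
  (\<open>mean_triangular_operator\<close>). After division by \<open>2 N\<close>, the first norm tends to zero, whereas the truncations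
  keep norm at most \<open>1\<close> and integral \<open>1/4\<close>.\<close>


section \<open>Square integrable kernels and their forms\<close>

interpretation unit_interval: finite_measure unit_measure
  by (simp add: finite_measureI emeasure_restrict_space)

interpretation unit_square: pair_sigma_finite unit_measure unit_measure ..

interpretation unit_square: finite_measure square_measure
  by (intro finite_measure_pair_measure unit_interval.finite_measure_axioms)

lemma space_square_measure: "space square_measure = {0..1} \<times> {0..1}"
  by (simp add: space_pair_measure space_restrict_space)

lemma AE_unit_neq: "AE x in unit_measure. x \<noteq> c"
  using AE_lborel_singleton[of c] by (subst AE_restrict_space_iff) auto

lemma rep_L2_0: "AE x in unit_measure. rep_L2 0 x = 0"
  unfolding zero_L2_def by (simp add: AE_rep_abs square_integrable_zero)

lemma AE_rep_scaleR: "AE x in unit_measure. rep_L2 (r *\<^sub>R f) x = of_real r * rep_L2 f x"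
  using AE_rep_scaleC[of "of_real r" f] by (simp add: scaleC_of_real)

lemma borel_measurable_complex_cnj [measurable]:
  "f \<in> borel_measurable M \<Longrightarrow> (\<lambda>x. cnj (f x)) \<in> borel_measurable M"
  by (rule borel_measurable_continuous_on[where f = cnj]) (intro continuous_intros)

lemma rep_L2_measurable [measurable]: "rep_L2 f \<in> borel_measurable unit_measure"
  by (rule square_integrable_measurable[OF square_integrable_rep])

lemma integrable_norm_rep: "integrable unit_measure (\<lambda>x. (norm (rep_L2 f x))\<^sup>2)"
  using square_integrable_rep by (simp add: square_integrable_def)

lemma integrable_rep: "integrable unit_measure (rep_L2 f)"
proof -
  have "square_integrable unit_measure (\<lambda>x. 1)"
    by (simp add: square_integrable_def)
  from HS_pointwise(1)[OF this square_integrable_rep] show ?thesis by simp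
qed

lemma power2_norm_L2: "(norm f)\<^sup>2 = (\<integral>x. (norm (rep_L2 f x))\<^sup>2 \<partial>unit_measure)"
  by (simp add: norm_L2_rep)

lemma inner_L2_rep: "inner f g = Re (\<integral>x. rep_L2 f x * cnj (rep_L2 g x) \<partial>unit_measure)"
proof -
  have "integrable unit_measure (\<lambda>x. rep_L2 f x * cnj (rep_L2 g x))"
    by (rule Bochner_Integration.integrable_bound[OF square_integrable_mult[OF square_integrable_rep
        square_integrable_rep]])
      (auto simp: norm_mult)
  then show ?thesis
    by (simp add: inner_L2.rep_eq inner_complex_def flip: integral_Re)
qed

lemma L2_inner_eqI: "(\<And>h. inner f h = inner g h) \<Longrightarrow> f = (g :: L2)"
  by (metis eq_iff_diff_eq_0 inner_diff_left inner_eq_zero_iff)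

lemma square_integrable_cong:
  assumes k: "square_integrable M k" and eq: "\<And>p. p \<in> space M \<Longrightarrow> k p = l p"
  shows "square_integrable M l"
proof -
  have "l \<in> borel_measurable M \<longleftrightarrow> k \<in> borel_measurable M"
    using eq by (intro measurable_cong) auto
  moreover have "integrable M (\<lambda>p. (norm (l p))\<^sup>2) \<longleftrightarrow> integrable M (\<lambda>p. (norm (k p))\<^sup>2)"
    using eq by (intro Bochner_Integration.integrable_cong) auto
  ultimately show ?thesis using k by (simp add: square_integrable_def)
qed

lemma integrable_kernel_form:
  assumes k: "square_integrable square_measure k"
  shows "integrable square_measure (\<lambda>(x, y). k (x, y) * rep_L2 f x * cnj (rep_L2 g y))"
proof -
  have [measurable]: "k \<in> borel_measurable square_measure"
    by (rule square_integrable_measurable[OF k])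
  have "integrable square_measure (\<lambda>(x, y). (norm (rep_L2 f x))\<^sup>2 * (norm (rep_L2 g y))\<^sup>2)"
    by (rule unit_square.Fubini_integrable) (simp_all add: abs_mult integrable_norm_rep)
  then have fg: "square_integrable square_measure (\<lambda>p. rep_L2 f (fst p) * cnj (rep_L2 g (snd p)))"
    by (simp add: square_integrable_def norm_mult power_mult_distrib split_beta')
  show ?thesis
    by (rule Bochner_Integration.integrable_bound[OF square_integrable_mult[OF k fg]])
      (auto simp: norm_mult mult.assoc)
qed

text \<open>The sesquilinear form of an integral operator is a double integral. Operator identities become
  identities between integrands here, so that sums, adjoints and the Schur test need no
  handling of representatives.\<close>

lemma inner_HS_operator:
  assumes k: "square_integrable square_measure k"
  shows "inner (HS_operator k f) g =
    Re (\<integral>(x, y). k (x, y) * rep_L2 f x * cnj (rep_L2 g y) \<partial>square_measure)"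
proof -
  have [measurable]: "k \<in> borel_measurable square_measure"
    by (rule square_integrable_measurable[OF k])
  have "inner (HS_operator k f) g =
      Re (\<integral>y. (\<integral>x. k (x, y) * rep_L2 f x \<partial>unit_measure) * cnj (rep_L2 g y) \<partial>unit_measure)"
    unfolding HS_operator_apply[OF k] inner_L2_rep
    using AE_integral_transform[OF k, of f]
    by (intro arg_cong[where f = Re] integral_cong_AE) (measurable, auto)
  also have "\<dots> = Re (\<integral>y. (\<integral>x. k (x, y) * rep_L2 f x * cnj (rep_L2 g y) \<partial>unit_measure)
      \<partial>unit_measure)"
    by simp
  also have "\<dots> = Re (\<integral>(x, y). k (x, y) * rep_L2 f x * cnj (rep_L2 g y) \<partial>square_measure)"
    using unit_square.integral_snd[OF integrable_kernel_form[OF k, of f g]] by simp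
  finally show ?thesis .
qed

lemma HS_operator_cong:
  assumes k: "square_integrable square_measure k" and l: "square_integrable square_measure l"
    and eq: "AE p in square_measure. k p = l p"
  shows "HS_operator k = HS_operator l"
proof (intro blinfun_eqI L2_inner_eqI)
  fix f h
  have [measurable]: "k \<in> borel_measurable square_measure" "l \<in> borel_measurable square_measure"
    by (rule square_integrable_measurable; fact)+
  show "inner (HS_operator k f) h = inner (HS_operator l f) h"
    unfolding inner_HS_operator[OF k] inner_HS_operator[OF l]
    using eq by (intro arg_cong[where f = Re] integral_cong_AE) (measurable, auto)
qed

lemma HS_operator_add:
  assumes k: "square_integrable square_measure k" and l: "square_integrable square_measure l"
  shows "HS_operator (\<lambda>p. k p + l p) = HS_operator k + HS_operator l"
proof (intro blinfun_eqI L2_inner_eqI)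
  fix f h
  show "inner (HS_operator (\<lambda>p. k p + l p) f) h = inner ((HS_operator k + HS_operator l) f) h"
    unfolding blinfun.add_left inner_add_left inner_HS_operator[OF k] inner_HS_operator[OF l]
      inner_HS_operator[OF square_integrable_add[OF k l]]
    using Bochner_Integration.integral_add[OF integrable_kernel_form[OF k, of f h]
        integrable_kernel_form[OF l, of f h]]
    by (simp add: split_beta' algebra_simps)
qed

lemma HS_operator_scaleC:
  assumes k: "square_integrable square_measure k"
  shows "HS_operator (\<lambda>p. c * k p) = c *\<^sub>C HS_operator k"
proof (rule blinfun_eqI, rule L2_eqI)
  fix f
  have [measurable]: "k \<in> borel_measurable square_measure"
    by (rule square_integrable_measurable[OF k])
  show "AE y in unit_measure. rep_L2 (HS_operator (\<lambda>p. c * k p) f) y =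
      rep_L2 ((c *\<^sub>C HS_operator k) f) y"
    unfolding scaleC_blinfun.rep_eq HS_operator_apply[OF k] HS_operator_apply[OF
        square_integrable_cmult[OF k]]
    using AE_integral_transform[OF k, of f] AE_integral_transform[OF
        square_integrable_cmult[OF k], of c f]
      AE_rep_scaleC[of c "integral_transform k f"]
    by eventually_elim (simp add: mult.assoc)
qed

lemma scaleC_zero: "0 *\<^sub>C x = 0"
  using scaleC_of_real[of 0 x] by simp

lemma scaleC_minus_one: "(-1) *\<^sub>C x = - x"
  using scaleC_of_real[of "-1" x] by simp

lemma HS_operator_zero: "HS_operator (\<lambda>p. 0) = 0"
  using HS_operator_scaleC[OF square_integrable_zero, of 0] by (simp add: scaleC_zero)

lemma inner_HS_operator_adjoint:
  assumes k: "square_integrable square_measure k"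
    and k': "square_integrable square_measure (\<lambda>(x, y). cnj (k (y, x)))"
  shows "inner (HS_operator k f) g = inner f (HS_operator (\<lambda>(x, y). cnj (k (y, x))) g)"
proof -
  have "inner f (HS_operator (\<lambda>(x, y). cnj (k (y, x))) g) = 
    Re (\<integral>(x, y). cnj (k (y, x)) * rep_L2 g x * cnj (rep_L2 f y) \<partial>square_measure)"
    using inner_HS_operator[OF k', of g f] by (simp add: inner_commute)
  also have "\<dots> = Re (\<integral>(y, x). cnj (k (y, x)) * rep_L2 g x * cnj (rep_L2 f y) \<partial>square_measure)"
    using unit_square.integral_product_swap[of
        "\<lambda>(y, x). cnj (k (y, x)) * rep_L2 g x * cnj (rep_L2 f y)"] 
      square_integrable_measurable[OF k]
    by (simp add: split_beta')
  also have "\<dots> = Re (cnj (\<integral>(y, x). k (y, x) * rep_L2 f y * cnj (rep_L2 g x) \<partial>square_measure))"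
    unfolding Bochner_Integration.integral_cnj[symmetric] by (simp add: split_beta' mult_ac)
  also have "\<dots> = inner (HS_operator k f) g"
    by (simp add: inner_HS_operator[OF k])
  finally show ?thesis by simp
qed


section \<open>Bounded kernels and the Schur test\<close>

text \<open>Boundedness is required everywhere, and not only on the unit square: sections of a bounded
  kernel are then bounded without a side condition.\<close>

definition bounded_kernel :: "(real \<times> real \<Rightarrow> complex) \<Rightarrow> bool"
  where "bounded_kernel k \<longleftrightarrow> k \<in> borel_measurable square_measure \<and> bounded (range k)"

lemma bounded_kernel_measurable [measurable_dest]:
  "bounded_kernel k \<Longrightarrow> k \<in> borel_measurable square_measure"
  by (simp add: bounded_kernel_def)

lemma bounded_kernelE:
  assumes "bounded_kernel k" obtains B where "B > 0" "\<And>p. norm (k p) \<le> B"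
  using assms by (metis bounded_kernel_def bounded_pos rangeI)

lemma bounded_kernelI:
  "k \<in> borel_measurable square_measure \<Longrightarrow> (\<And>p. norm (k p) \<le> B) \<Longrightarrow> bounded_kernel k"
  by (auto simp: bounded_kernel_def bounded_iff)

lemma square_integrable_bounded_kernel:
  assumes k: "bounded_kernel k" shows "square_integrable square_measure k"
proof -
  note [measurable] = bounded_kernel_measurable[OF k]
  obtain B where B: "\<And>p. norm (k p) \<le> B"
    using bounded_kernelE[OF k] by metis
  have "integrable square_measure (\<lambda>p. (norm (k p))\<^sup>2)"
    by (rule unit_square.integrable_const_bound[of _ "B\<^sup>2"]) (auto simp: B power_mono)
  then show ?thesis by (simp add: square_integrable_def)
qed

lemma bounded_kernel_add:
  assumes k: "bounded_kernel k" and l: "bounded_kernel l"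
  shows "bounded_kernel (\<lambda>p. k p + l p)"
proof -
  note [measurable] = bounded_kernel_measurable[OF k] bounded_kernel_measurable[OF l]
  obtain B where B: "\<And>p. norm (k p) \<le> B"
    using bounded_kernelE[OF k] by metis
  obtain C where C: "\<And>p. norm (l p) \<le> C"
    using bounded_kernelE[OF l] by metis
  show ?thesis
    by (rule bounded_kernelI[of _ "B + C"], measurable) (rule norm_triangle_mono[OF B C])
qed

lemma bounded_kernel_cmult:
  assumes k: "bounded_kernel k"
  shows "bounded_kernel (\<lambda>p. c * k p)"
proof -
  note [measurable] = bounded_kernel_measurable[OF k]
  obtain B where B: "\<And>p. norm (k p) \<le> B"
    using bounded_kernelE[OF k] by metis
  have "norm (c * k p) \<le> norm c * B" for p
    unfolding norm_mult by (intro mult_left_mono B norm_ge_zero)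
  moreover have "(\<lambda>p. c * k p) \<in> borel_measurable square_measure" by measurable
  ultimately show ?thesis by (intro bounded_kernelI)
qed

lemma bounded_kernel_sum:
  "(\<And>i. i \<in> I \<Longrightarrow> bounded_kernel (k i)) \<Longrightarrow> bounded_kernel (\<lambda>p. \<Sum>i\<in>I. k i p)"
proof (induction I rule: infinite_finite_induct)
  case (insert i I)
  then show ?case by (simp add: bounded_kernel_add)
qed (auto intro: bounded_kernelI[of _ 0])

lemma bounded_kernel_adjoint: 
  assumes k: "bounded_kernel k" shows "bounded_kernel (\<lambda>(x, y). cnj (k (y, x)))"
proof -
  note [measurable] = bounded_kernel_measurable[OF k]
  obtain B where B: "\<And>p. norm (k p) \<le> B"
    using bounded_kernelE[OF k] by metis
  show ?thesis
    by (rule bounded_kernelI[of _ B]) (auto simp: B)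
qed

lemma bounded_kernel_compose:
  assumes k: "bounded_kernel k" and l: "bounded_kernel l"
  shows "bounded_kernel (\<lambda>(x, y). \<integral>z. l (x, z) * k (z, y) \<partial>unit_measure)"
proof -
  note [measurable] = bounded_kernel_measurable[OF k] bounded_kernel_measurable[OF l]
  obtain B where B: "\<And>p. norm (k p) \<le> B" "B > 0"
    using bounded_kernelE[OF k] by metis
  obtain C where C: "\<And>p. norm (l p) \<le> C" "C > 0"
    using bounded_kernelE[OF l] by metis
  have "norm (\<integral>z. l (x, z) * k (z, y) \<partial>unit_measure) \<le> C * B" for x y
  proof -
    have "norm (\<integral>z. l (x, z) * k (z, y) \<partial>unit_measure) \<le>
        (\<integral>z. norm (l (x, z) * k (z, y)) \<partial>unit_measure)"
      by (rule integral_norm_bound)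
    also have "\<dots> \<le> (\<integral>z. C * B \<partial>unit_measure)"
      by (rule integral_mono') (use B C in \<open>auto simp: norm_mult intro!: mult_mono\<close>)
    finally show ?thesis
      by (simp add: measure_restrict_space space_restrict_space)
  qed
  then show ?thesis
    by (intro bounded_kernelI[of _ "C * B"]) auto
qed

text \<open>Fubini's theorem; the kernel of the product is the analogue of a product of matrices.\<close>

lemma HS_operator_compose:
  assumes k: "bounded_kernel k" and l: "bounded_kernel l"
    and m: "square_integrable square_measure (\<lambda>(x, y). \<integral>z. l (x, z) * k (z, y) \<partial>unit_measure)"
  shows "HS_operator k (HS_operator l f) =
    HS_operator (\<lambda>(x, y). \<integral>z. l (x, z) * k (z, y) \<partial>unit_measure) f"
proof (rule L2_eqI)
  note [measurable] = bounded_kernel_measurable[OF k] bounded_kernel_measurable[OF l]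
  note sk = square_integrable_bounded_kernel[OF k] and sl = square_integrable_bounded_kernel[OF l]
  obtain B where B: "\<And>p. norm (k p) \<le> B" "B > 0"
    using bounded_kernelE[OF k] by metis
  obtain C where C: "\<And>p. norm (l p) \<le> C" "C > 0"
    using bounded_kernelE[OF l] by metis
  show "AE y in unit_measure. rep_L2 (HS_operator k (HS_operator l f)) y =
    rep_L2 (HS_operator (\<lambda>(x, y). \<integral>z. l (x, z) * k (z, y) \<partial>unit_measure) f) y"
    unfolding HS_operator_apply[OF sk] HS_operator_apply[OF sl] HS_operator_apply[OF m]
    using AE_integral_transform[OF sk, of "integral_transform l f"] AE_integral_transform[OF m,
        of f] AE_space
  proof eventually_elim
    case (elim y)
    have [measurable]: "(\<lambda>z. k (z, y)) \<in> borel_measurable unit_measure"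
      using elim(3) by measurable
    have bd: "norm (k (z, y) * (l (x, z) * rep_L2 f x)) \<le> B * C * norm (rep_L2 f x)" for x z
      using B C by (auto simp: norm_mult mult.assoc intro!: mult_mono)
    have "integrable square_measure (\<lambda>(z, x). (B * C) * norm (rep_L2 f x))"
      by (rule unit_square.Fubini_integrable) (use integrable_norm[OF integrable_rep] in \<open>simp_all
          add: abs_mult\<close>)
    then have int: "integrable square_measure (\<lambda>(z, x). k (z, y) * (l (x, z) * rep_L2 f x))"
      by (rule Bochner_Integration.integrable_bound)
        (use bd B C in \<open>auto simp: abs_mult\<close>)
    have "(\<integral>z. k (z, y) * rep_L2 (integral_transform l f) z \<partial>unit_measure) =
      (\<integral>z. k (z, y) * (\<integral>x. l (x, z) * rep_L2 f x \<partial>unit_measure) \<partial>unit_measure)"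
      using AE_integral_transform[OF sl, of f] by (intro integral_cong_AE) (measurable, auto)
    also have "\<dots> = (\<integral>z. (\<integral>x. k (z, y) * (l (x, z) * rep_L2 f x) \<partial>unit_measure) \<partial>unit_measure)"
      by simp
    also have "\<dots> = (\<integral>x. (\<integral>z. k (z, y) * (l (x, z) * rep_L2 f x) \<partial>unit_measure) \<partial>unit_measure)"
      using unit_square.Fubini_integral[OF int] by simp
    also have "\<dots> = (\<integral>x. (\<integral>z. l (x, z) * k (z, y) \<partial>unit_measure) * rep_L2 f x \<partial>unit_measure)"
      by (simp add: mult_ac flip: integral_mult_left_zero)
    finally show ?case using elim(1,2) by simp
  qed
qed

lemma integrable_schur:
  assumes k: "bounded_kernel k"
  shows "integrable square_measure (\<lambda>(x, y). norm (k (x, y)) * (norm (rep_L2 f x))\<^sup>2)"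
    and "integrable square_measure (\<lambda>(x, y). norm (k (x, y)) * (norm (rep_L2 f y))\<^sup>2)"
proof -
  note [measurable] = bounded_kernel_measurable[OF k]
  obtain B where B: "\<And>p. norm (k p) \<le> B" "B > 0"
    using bounded_kernelE[OF k] by metis
  have "integrable square_measure (\<lambda>(x, y). B * (norm (rep_L2 f x))\<^sup>2)"
    by (rule unit_square.Fubini_integrable) (simp_all add: integrable_norm_rep abs_mult)
  then show "integrable square_measure (\<lambda>(x, y). norm (k (x, y)) * (norm (rep_L2 f x))\<^sup>2)"
    by (rule Bochner_Integration.integrable_bound) (use B in \<open>auto simp: abs_mult intro!: AE_I2
        mult_right_mono\<close>)
  have "integrable square_measure (\<lambda>(x, y). B * (norm (rep_L2 f y))\<^sup>2)"
    by (rule unit_square.Fubini_integrable) (simp_all add: integrable_norm_rep abs_mult)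
  then show "integrable square_measure (\<lambda>(x, y). norm (k (x, y)) * (norm (rep_L2 f y))\<^sup>2)"
    by (rule Bochner_Integration.integrable_bound) (use B in \<open>auto simp: abs_mult intro!: AE_I2
        mult_right_mono\<close>)
qed

text \<open>In the form of the operator, \<open>|f(x) g(y)| \<le> (|f(x)|\<^sup>2 + |g(y)|\<^sup>2) / 2\<close>; integrating each square
  first in the variable on which it does not depend gives \<open>C (\<parallel>f\<parallel>\<^sup>2 + \<parallel>g\<parallel>\<^sup>2) / 2\<close>, and scaling \<open>g\<close> to
  the norm of \<open>f\<close> turns this into the operator bound.\<close>

lemma schur_test:
  assumes k: "bounded_kernel k"
    and x: "\<And>x. x \<in> {0..1} \<Longrightarrow> (\<integral>y. norm (k (x, y)) \<partial>unit_measure) \<le> C"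
    and y: "\<And>y. y \<in> {0..1} \<Longrightarrow> (\<integral>x. norm (k (x, y)) \<partial>unit_measure) \<le> C"
  shows "norm (HS_operator k) \<le> C"
proof -
  note [measurable] = bounded_kernel_measurable[OF k]
  note sk = square_integrable_bounded_kernel[OF k]
  have "0 \<le> (\<integral>y. norm (k (0, y)) \<partial>unit_measure)" by simp
  also have "\<dots> \<le> C" by (rule x) simp
  finally have C: "0 \<le> C" .
  have form: "inner (HS_operator k f) g \<le> C / 2 * ((norm f)\<^sup>2 + (norm g)\<^sup>2)" for f g
  proof -
    have "inner (HS_operator k f) g \<le>
        norm (\<integral>(x, y). k (x, y) * rep_L2 f x * cnj (rep_L2 g y) \<partial>square_measure)"
      unfolding inner_HS_operator[OF sk] by (rule complex_Re_le_cmod)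
    also have "\<dots> \<le> (\<integral>p. norm (case p of (x, y) \<Rightarrow>
        k (x, y) * rep_L2 f x * cnj (rep_L2 g y)) \<partial>square_measure)"
      by (rule integral_norm_bound)
    also have "\<dots> \<le> (\<integral>p. ((case p of (x, y) \<Rightarrow> norm (k (x, y)) * (norm (rep_L2 f x))\<^sup>2) +
        (case p of (x, y) \<Rightarrow> norm (k (x, y)) * (norm (rep_L2 g y))\<^sup>2)) / 2 \<partial>square_measure)"
    proof (intro integral_mono integrable_norm integrable_kernel_form[OF sk] integrable_divide_zero
        Bochner_Integration.integrable_add integrable_schur[OF k])
      fix p :: "real \<times> real"
      obtain x y where p: "p = (x, y)" by fastforce
      have "norm (rep_L2 f x) * norm (rep_L2 g y) \<le>
          ((norm (rep_L2 f x))\<^sup>2 + (norm (rep_L2 g y))\<^sup>2) / 2"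
        using zero_le_power2[of "norm (rep_L2 f x) - norm (rep_L2 g y)"]
        by (simp add: power2_eq_square algebra_simps)
      then have "norm (k p) * (norm (rep_L2 f x) * norm (rep_L2 g y)) \<le>
          norm (k p) * (((norm (rep_L2 f x))\<^sup>2 + (norm (rep_L2 g y))\<^sup>2) / 2)"
        by (rule mult_left_mono) simp
      then show "norm (case p of (x, y) \<Rightarrow> k (x, y) * rep_L2 f x * cnj (rep_L2 g y)) \<le>
        ((case p of (x, y) \<Rightarrow> norm (k (x, y)) * (norm (rep_L2 f x))\<^sup>2) +
        (case p of (x, y) \<Rightarrow> norm (k (x, y)) * (norm (rep_L2 g y))\<^sup>2)) / 2"
        by (simp add: p norm_mult algebra_simps)
    qed
    also have "\<dots> = ((\<integral>(x, y). norm (k (x, y)) * (norm (rep_L2 f x))\<^sup>2 \<partial>square_measure) +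
        (\<integral>(x, y). norm (k (x, y)) * (norm (rep_L2 g y))\<^sup>2 \<partial>square_measure)) / 2"
      using integrable_schur[OF k] by simp
    also have "(\<integral>(x, y). norm (k (x, y)) * (norm (rep_L2 f x))\<^sup>2 \<partial>square_measure) =
        (\<integral>x. (\<integral>y. norm (k (x, y)) * (norm (rep_L2 f x))\<^sup>2 \<partial>unit_measure) \<partial>unit_measure)"
      using unit_square.integral_fst[OF integrable_schur(1)[OF k, of f]] by simp
    also have "\<dots> \<le> (\<integral>x. C * (norm (rep_L2 f x))\<^sup>2 \<partial>unit_measure)"
    proof (rule integral_mono)
      show "integrable unit_measure (\<lambda>x. \<integral>y. norm (k (x, y)) * (norm (rep_L2 f x))\<^sup>2 \<partial>unit_measure)"
        using unit_square.integrable_fst[OF integrable_schur(1)[OF k, of f]] by simp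
    qed (auto simp: space_restrict_space integrable_norm_rep intro!: mult_right_mono x)
    also have "\<dots> = C * (norm f)\<^sup>2" by (simp add: power2_norm_L2)
    also have "(\<integral>(x, y). norm (k (x, y)) * (norm (rep_L2 g y))\<^sup>2 \<partial>square_measure) =
        (\<integral>y. (\<integral>x. norm (k (x, y)) * (norm (rep_L2 g y))\<^sup>2 \<partial>unit_measure) \<partial>unit_measure)"
      using unit_square.integral_snd[OF integrable_schur(2)[OF k, of g]] by simp
    also have "\<dots> \<le> (\<integral>y. C * (norm (rep_L2 g y))\<^sup>2 \<partial>unit_measure)"
    proof (rule integral_mono)
      show "integrable unit_measure (\<lambda>y. \<integral>x. norm (k (x, y)) * (norm (rep_L2 g y))\<^sup>2 \<partial>unit_measure)"
        using unit_square.integrable_snd[OF integrable_schur(2)[OF k, of g]] by simp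
    qed (auto simp: space_restrict_space integrable_norm_rep intro!: mult_right_mono y)
    also have "\<dots> = C * (norm g)\<^sup>2" by (simp add: power2_norm_L2)
    finally show ?thesis by (simp add: algebra_simps add_divide_distrib)
  qed
  show ?thesis
  proof (rule norm_blinfun_bound[OF C])
    fix f
    define u where "u = HS_operator k f"
    show "norm (HS_operator k f) \<le> C * norm f"
    proof (cases "u = 0")
      case True then show ?thesis by (simp add: u_def C)
    next
      case False
      \<comment> \<open>The direction of \<open>u\<close> realises its norm, and the length of \<open>f\<close> balances the two squares.\<close>
      define g where "g = (norm f / norm u) *\<^sub>R u"
      have ng: "norm g = norm f" using False by (simp add: g_def)
      have "norm u * norm f = inner u g"
        using False by (simp add: g_def power2_norm_eq_inner[symmetric] power2_eq_square)
      also have "\<dots> \<le> C * norm f * norm f"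
        using form[of f g] by (simp add: ng u_def power2_eq_square)
      finally show ?thesis
        by (cases "norm f = 0") (auto simp: u_def blinfun.zero_right mult_le_cancel_right)
    qed
  qed
qed

lemma norm_HS_operator_adjoint_le:
  assumes k: "bounded_kernel k"
  shows "norm (HS_operator (\<lambda>(x, y). cnj (k (y, x)))) \<le> norm (HS_operator k)"
proof (rule norm_blinfun_bound)
  fix g
  define u where "u = HS_operator (\<lambda>(x, y). cnj (k (y, x))) g"
  have "norm u * norm u = inner (HS_operator k u) g"
    using inner_HS_operator_adjoint[of k u g] k
    by (simp add: u_def square_integrable_bounded_kernel bounded_kernel_adjoint
        flip: power2_norm_eq_inner power2_eq_square)
  also have "\<dots> \<le> norm (HS_operator k u) * norm g"
    by (rule norm_cauchy_schwarz)
  also have "\<dots> \<le> norm (HS_operator k) * norm u * norm g"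
    by (intro mult_right_mono norm_blinfun norm_ge_zero)
  finally show "norm (HS_operator (\<lambda>(x, y). cnj (k (y, x))) g) \<le> norm (HS_operator k) * norm g"
    unfolding u_def[symmetric] by (cases "norm u = 0") (auto simp: mult_ac mult_le_cancel_left)
qed simp

text \<open>One half of the C*-identity \<open>\<parallel>K\<parallel>\<^sup>2 = \<parallel>K\<^sup>* K\<parallel>\<close>, with the product written as a kernel. It makes
  cancellation visible to the Schur test, which by itself only sees absolute values.\<close>

lemma norm_HS_operator_power2_le:
  assumes k: "bounded_kernel k"
  shows "(norm (HS_operator k))\<^sup>2 \<le>
    norm (HS_operator (\<lambda>(x, y). \<integral>z. k (x, z) * cnj (k (y, z)) \<partial>unit_measure))"
    (is "_ \<le> norm ?Q")
proof -
  let ?k' = "\<lambda>(x, y). cnj (k (y, x))"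
  note k' = bounded_kernel_adjoint[OF k]
  note s = square_integrable_bounded_kernel
  have Q: "?Q f = HS_operator ?k' (HS_operator k f)" for f
    using HS_operator_compose[OF k' k s[OF bounded_kernel_compose[OF k' k]]] by simp
  have "norm (HS_operator k) \<le> sqrt (norm ?Q)"
  proof (rule norm_blinfun_bound)
    fix f
    have "(norm (HS_operator k f))\<^sup>2 = inner f (?Q f)"
      using inner_HS_operator_adjoint[OF s[OF k] s[OF k'], of f "HS_operator k f"]
      by (simp add: Q power2_norm_eq_inner)
    also have "\<dots> \<le> norm f * norm (?Q f)"
      by (rule norm_cauchy_schwarz)
    also have "\<dots> \<le> norm f * (norm ?Q * norm f)"
      by (intro mult_left_mono norm_blinfun norm_ge_zero)
    finally have "(norm (HS_operator k f))\<^sup>2 \<le> (sqrt (norm ?Q) * norm f)\<^sup>2"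
      by (simp add: power_mult_distrib mult_ac power2_eq_square)
    then show "norm (HS_operator k f) \<le> sqrt (norm ?Q) * norm f"
      by (rule power2_le_imp_le) simp
  qed simp
  then have "(norm (HS_operator k))\<^sup>2 \<le> (sqrt (norm ?Q))\<^sup>2"
    by (intro power_mono) auto
  then show ?thesis by simp
qed


section \<open>Restricting functions to intervals\<close>

definition cutoff :: "real set \<Rightarrow> L2 \<Rightarrow> L2"
  where "cutoff A f = abs_L2 (\<lambda>x. indicator A x * rep_L2 f x)"

lemma measurable_indicator_unit [measurable]:
  fixes A :: "real set"
  assumes "A \<in> sets borel"
  shows "(indicator A :: real \<Rightarrow> 'b::{zero_neq_one, topological_space}) \<in>
      borel_measurable unit_measure"
  using assms by (intro measurable_restrict_space1) auto

lemma AE_rep_cutoff: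
  assumes A: "A \<in> sets borel"
  shows "AE x in unit_measure. rep_L2 (cutoff A f) x = indicator A x * rep_L2 f x"
proof -
  note [measurable] = A
  have "integrable unit_measure (\<lambda>x. (norm (indicator A x * rep_L2 f x))\<^sup>2)"
    by (rule Bochner_Integration.integrable_bound[OF integrable_norm_rep[of f]])
      (auto split: split_indicator)
  then have "square_integrable unit_measure (\<lambda>x. indicator A x * rep_L2 f x)"
    by (simp add: square_integrable_def)
  then show ?thesis
    unfolding cutoff_def by (rule AE_rep_abs)
qed

lemma norm_cutoff_power2:
  assumes A: "A \<in> sets borel"
  shows "(norm (cutoff A f))\<^sup>2 = (\<integral>x. indicator A x * (norm (rep_L2 f x))\<^sup>2 \<partial>unit_measure)"
  unfolding power2_norm_L2
proof (rule integral_cong_AE)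
  note [measurable] = A
  show "(\<lambda>x. indicator A x * (norm (rep_L2 f x))\<^sup>2) \<in> borel_measurable unit_measure"
    by measurable
  show "AE x in unit_measure. (norm (rep_L2 (cutoff A f) x))\<^sup>2 =
      indicator A x * (norm (rep_L2 f x))\<^sup>2"
    using AE_rep_cutoff[OF A, of f] by eventually_elim (auto simp: indicator_def)
qed measurable

lemma bounded_linear_cutoff:
  assumes A: "A \<in> sets borel"
  shows "bounded_linear (cutoff A)"
proof (rule bounded_linear_intro[where K = 1])
  fix f g r
  show "cutoff A (f + g) = cutoff A f + cutoff A g"
  proof (rule L2_eqI)
    show "AE x in unit_measure. rep_L2 (cutoff A (f + g)) x = rep_L2 (cutoff A f + cutoff A g) x"
      using AE_rep_cutoff[OF A, of f] AE_rep_cutoff[OF A, of g] AE_rep_cutoff[OF A, of "f + g"]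
        AE_rep_add[of f g] AE_rep_add[of "cutoff A f" "cutoff A g"]
      by eventually_elim (simp add: distrib_left)
  qed
  show "cutoff A (r *\<^sub>R f) = r *\<^sub>R cutoff A f"
  proof (rule L2_eqI)
    show "AE x in unit_measure. rep_L2 (cutoff A (r *\<^sub>R f)) x = rep_L2 (r *\<^sub>R cutoff A f) x"
      using AE_rep_cutoff[OF A, of f] AE_rep_cutoff[OF A, of "r *\<^sub>R f"]
        AE_rep_scaleR[of r f] AE_rep_scaleR[of r "cutoff A f"]
      by eventually_elim simp
  qed
  have "(norm (cutoff A f))\<^sup>2 \<le> (norm f)\<^sup>2"
    unfolding norm_cutoff_power2[OF A] power2_norm_L2[of f]
    by (rule integral_mono') (auto simp: integrable_norm_rep indicator_def)
  then show "norm (cutoff A f) \<le> norm f * 1"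
    using power2_le_imp_le[of "norm (cutoff A f)" "norm f"] by simp
qed

lemma cutoff_cutoff:
  assumes A: "A \<in> sets borel" and B: "B \<in> sets borel"
  shows "cutoff A (cutoff B f) = cutoff (A \<inter> B) f"
proof (rule L2_eqI)
  show "AE x in unit_measure. rep_L2 (cutoff A (cutoff B f)) x = rep_L2 (cutoff (A \<inter> B) f) x"
    using AE_rep_cutoff[OF A, of "cutoff B f"] AE_rep_cutoff[OF B, of f] AE_rep_cutoff[OF
        sets.Int[OF A B], of f]
    by eventually_elim (simp add: indicator_inter_arith)
qed

lemma cutoff_Un:
  assumes A: "A \<in> sets borel" and B: "B \<in> sets borel" and disj: "A \<inter> B = {}"
  shows "cutoff (A \<union> B) f = cutoff A f + cutoff B f"
proof (rule L2_eqI)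
  show "AE x in unit_measure. rep_L2 (cutoff (A \<union> B) f) x = rep_L2 (cutoff A f + cutoff B f) x"
    using AE_rep_cutoff[OF A, of f] AE_rep_cutoff[OF B, of f] AE_rep_cutoff[OF
        sets.Un[OF A B], of f]
      AE_rep_add[of "cutoff A f" "cutoff B f"]
    by eventually_elim (use disj in \<open>auto simp: indicator_def\<close>)
qed

lemma cutoff_self:
  assumes A: "A \<in> sets borel" and full: "AE x in unit_measure. x \<in> A"
  shows "cutoff A f = f"
proof (rule L2_eqI)
  show "AE x in unit_measure. rep_L2 (cutoff A f) x = rep_L2 f x"
    using AE_rep_cutoff[OF A, of f] full by eventually_elim simp
qed

text \<open>Functions with disjoint supports are orthogonal, so \<open>A \<mapsto> \<parallel>cutoff A f\<parallel>\<^sup>2\<close> is additive.\<close>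

lemma norm_cutoff_Un_power2:
  assumes A: "A \<in> sets borel" and B: "B \<in> sets borel" and "A \<inter> B = {}"
  shows "(norm (cutoff (A \<union> B) f))\<^sup>2 = (norm (cutoff A f))\<^sup>2 + (norm (cutoff B f))\<^sup>2"
proof -
  have int: "integrable unit_measure (\<lambda>x. indicator A x * (norm (rep_L2 f x))\<^sup>2)"
      if "A \<in> sets borel" for A
    by (rule Bochner_Integration.integrable_bound[OF integrable_norm_rep[of f]])
      (use that in \<open>auto intro!: AE_I2 borel_measurable_times measurable_indicator_unit split:
          split_indicator\<close>)
  have "(norm (cutoff (A \<union> B) f))\<^sup>2 =
    (\<integral>x. indicator A x * (norm (rep_L2 f x))\<^sup>2 + indicator B x * (norm (rep_L2 f x))\<^sup>2
        \<partial>unit_measure)"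
    unfolding norm_cutoff_power2[OF sets.Un[OF A B]]
    by (rule Bochner_Integration.integral_cong) (use assms(3) in \<open>auto simp: indicator_def\<close>)
  then show ?thesis
    by (simp add: Bochner_Integration.integral_add int A B norm_cutoff_power2)
qed

text \<open>Compressing by cutoffs restricts the kernel to a rectangle.\<close>

lemma cutoff_HS_operator_cutoff:
  assumes A: "A \<in> sets borel" and B: "B \<in> sets borel" and k: "square_integrable square_measure k"
  shows "cutoff B (HS_operator k (cutoff A f)) =
    HS_operator (\<lambda>p. indicator A (fst p) * indicator B (snd p) * k p) f"
    and "square_integrable square_measure (\<lambda>p. indicator A (fst p) * indicator B (snd p) * k p)"
      (is "square_integrable _ ?k")
proof -
  note [measurable] = square_integrable_measurable[OF k] A B
  have "integrable square_measure (\<lambda>p. (norm (k p))\<^sup>2)"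
    using k by (simp add: square_integrable_def)
  then have "integrable square_measure (\<lambda>p. (norm (?k p))\<^sup>2)"
    by (rule Bochner_Integration.integrable_bound) (measurable, auto split: split_indicator)
  then show k': "square_integrable square_measure ?k"
    by (simp add: square_integrable_def)
  show "cutoff B (HS_operator k (cutoff A f)) = HS_operator ?k f"
    unfolding HS_operator_apply[OF k] HS_operator_apply[OF k']
  proof (rule L2_eqI)
    show "AE y in unit_measure. rep_L2 (cutoff B (integral_transform k (cutoff A f))) y =
        rep_L2 (integral_transform ?k f) y"
      using AE_integral_transform[OF k, of "cutoff A f"] AE_integral_transform[OF k', of f]
        AE_rep_cutoff[OF B, of "integral_transform k (cutoff A f)"] AE_space
    proof eventually_elim
      case (elim y)
      have [measurable]: "(\<lambda>x. k (x, y)) \<in> borel_measurable unit_measure"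
        using elim(4) by measurable
      have "(\<integral>x. k (x, y) * rep_L2 (cutoff A f) x \<partial>unit_measure) =
          (\<integral>x. k (x, y) * (indicator A x * rep_L2 f x) \<partial>unit_measure)"
        using AE_rep_cutoff[OF A, of f] by (intro integral_cong_AE) (measurable, auto)
      then have "rep_L2 (cutoff B (integral_transform k (cutoff A f))) y =
          (\<integral>x. indicator B y * (k (x, y) * (indicator A x * rep_L2 f x)) \<partial>unit_measure)"
        using elim(1,3) by simp
      also have "\<dots> = (\<integral>x. ?k (x, y) * rep_L2 f x \<partial>unit_measure)"
        by (rule Bochner_Integration.integral_cong) (auto simp: mult_ac)
      finally show ?case
        using elim(2) by simp
    qed
  qed
qed


section \<open>Compact operators\<close>

text \<open>Covering the image of the unit ball by any compact set suffices, because compact sets are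
  closed.\<close>

lemma compact_operatorsI:
  fixes T :: "L2 \<Rightarrow>\<^sub>L L2"
  assumes "\<And>c f. T (c *\<^sub>C f) = c *\<^sub>C T f" and "compact K" and "blinfun_apply T ` cball 0 1 \<subseteq> K"
  shows "T \<in> compact_operators"
proof -
  have "closure (blinfun_apply T ` cball 0 1) \<subseteq> K"
    by (rule closure_minimal[OF assms(3) compact_imp_closed[OF assms(2)]])
  then have "compact (K \<inter> closure (blinfun_apply T ` cball 0 1))"
    by (intro compact_Int_closed assms(2) closed_closure)
  with \<open>closure (blinfun_apply T ` cball 0 1) \<subseteq> K\<close> show ?thesis
    using assms(1) by (simp add: compact_operators_def Int_absorb1)
qed

lemma compact_operatorsD:
  assumes "T \<in> compact_operators"
  shows "T (c *\<^sub>C f) = c *\<^sub>C T f" and "compact (closure (blinfun_apply T ` cball 0 1))"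
  using assms by (auto simp: compact_operators_def)

lemma compact_operators_zero: "0 \<in> compact_operators"
proof (rule compact_operatorsI)
  show "blinfun_apply (0 :: L2 \<Rightarrow>\<^sub>L L2) (c *\<^sub>C f) = c *\<^sub>C blinfun_apply 0 f" for c f
    using norm_scaleC[of c "0 :: L2"] by simp
qed (auto intro: compact_sing[of 0])

lemma compact_operators_add:
  assumes S: "S \<in> compact_operators" and T: "T \<in> compact_operators"
  shows "S + T \<in> compact_operators"
proof (rule compact_operatorsI)
  show "(S + T) (c *\<^sub>C f) = c *\<^sub>C (S + T) f" for c f
    by (simp add: blinfun.add_left compact_operatorsD(1)[OF S] compact_operatorsD(1)[OF T]
        scaleC_add_right)
  show "compact {x + y | x y. x \<in> closure (blinfun_apply S ` cball 0 1) \<and>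
      y \<in> closure (blinfun_apply T ` cball 0 1)}"
    by (intro compact_sums compact_operatorsD(2) S T)
  show "blinfun_apply (S + T) ` cball 0 1 \<subseteq>
    {x + y | x y. x \<in> closure (blinfun_apply S ` cball 0 1) \<and> y \<in> closure (blinfun_apply T `
        cball 0 1)}"
  proof
    fix z assume "z \<in> blinfun_apply (S + T) ` cball 0 1"
    then obtain f where "f \<in> cball 0 1" "z = S f + T f" by (auto simp: blinfun.add_left)
    then show "z \<in> {x + y | x y. x \<in> closure (blinfun_apply S ` cball 0 1) \<and>
        y \<in> closure (blinfun_apply T ` cball 0 1)}"
      using closure_subset[of "blinfun_apply S ` cball 0 1"] closure_subset[of
          "blinfun_apply T ` cball 0 1"]
      by blast
  qed
qed

lemma compact_operators_scaleC:
  assumes T: "T \<in> compact_operators"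
  shows "c *\<^sub>C T \<in> compact_operators"
proof (rule compact_operatorsI)
  show "(c *\<^sub>C T) (d *\<^sub>C f) = d *\<^sub>C (c *\<^sub>C T) f" for d f
    by (simp add: scaleC_blinfun.rep_eq compact_operatorsD(1)[OF T] scaleC_scaleC mult.commute)
  show "compact ((*\<^sub>C) c ` closure (blinfun_apply T ` cball 0 1))"
    by (intro compact_continuous_image compact_operatorsD(2) T
        bounded_linear.continuous_on[OF bounded_linear_scaleC] continuous_on_id)
  show "blinfun_apply (c *\<^sub>C T) ` cball 0 1 \<subseteq> (*\<^sub>C) c ` closure (blinfun_apply T ` cball 0 1)"
    unfolding scaleC_blinfun.rep_eq using closure_subset[of "blinfun_apply T ` cball 0 1"] by blast
qed

lemma compact_operators_diff:
  assumes S: "S \<in> compact_operators" and T: "T \<in> compact_operators"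
  shows "S - T \<in> compact_operators"
  using compact_operators_add[OF S compact_operators_scaleC[OF T, of "-1"]]
  by (simp add: scaleC_minus_one)

lemma bounded_linear_scaleC_left: "bounded_linear (\<lambda>c. c *\<^sub>C (x :: L2))"
proof (rule bounded_linear_intro[where K = "norm x"])
  fix r c
  show "(r *\<^sub>R c) *\<^sub>C x = r *\<^sub>R c *\<^sub>C x"
    by (simp add: scaleR_conv_of_real flip: scaleC_of_real scaleC_scaleC)
qed (simp_all add: scaleC_add_left norm_scaleC)

text \<open>The unit ball is mapped into a disc in the complex line spanned by \<open>v\<close>.\<close>

lemma compact_HS_operator_rank_one:
  assumes u: "square_integrable unit_measure u" and v: "square_integrable unit_measure v"
    and uv: "square_integrable square_measure (\<lambda>(x, y). u x * v y)"
  shows "HS_operator (\<lambda>(x, y). u x * v y) \<in> compact_operators"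
proof (rule compact_operatorsI)
  define c where "c f = (\<integral>x. u x * rep_L2 f x \<partial>unit_measure)" for f
  have eq: "HS_operator (\<lambda>(x, y). u x * v y) f = c f *\<^sub>C abs_L2 v" for f
    unfolding HS_operator_apply[OF uv]
  proof (rule L2_eqI)
    show "AE y in unit_measure. rep_L2 (integral_transform (\<lambda>(x, y). u x * v y) f) y =
        rep_L2 (c f *\<^sub>C abs_L2 v) y"
      using AE_integral_transform[OF uv, of f] AE_rep_scaleC[of "c f" "abs_L2 v"] AE_rep_abs[OF v]
    proof eventually_elim
      case (elim y)
      have "(\<integral>x. (case (x, y) of (x, y) \<Rightarrow> u x * v y) * rep_L2 f x \<partial>unit_measure) =
          (\<integral>x. v y * (u x * rep_L2 f x) \<partial>unit_measure)"
        by (intro Bochner_Integration.integral_cong) auto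
      then show ?case
        using elim by (simp add: c_def)
    qed
  qed
  show "HS_operator (\<lambda>(x, y). u x * v y) (a *\<^sub>C f) =
      a *\<^sub>C HS_operator (\<lambda>(x, y). u x * v y) f" for a f
    unfolding HS_operator_apply[OF uv] by (rule integral_transform_scaleC[OF uv])
  \<comment> \<open>The Cauchy--Schwarz bound for the coefficient.\<close>
  define B where "B = sqrt (\<integral>x. (norm (u x))\<^sup>2 \<partial>unit_measure)"
  have c: "norm (c f) \<le> B" if "norm f \<le> 1" for f
  proof -
    have "(norm (c f))\<^sup>2 \<le> (\<integral>x. (norm (u x))\<^sup>2 \<partial>unit_measure) * (norm f)\<^sup>2"
      using HS_pointwise(2)[OF u square_integrable_rep, of f] by (simp add: c_def power2_norm_L2)
    also have "\<dots> \<le> (\<integral>x. (norm (u x))\<^sup>2 \<partial>unit_measure) * 1"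
      using that by (intro mult_left_mono) (auto simp: power_le_one)
    finally show ?thesis
      unfolding B_def by (intro real_le_rsqrt) simp
  qed
  show "compact ((\<lambda>c. c *\<^sub>C abs_L2 v) ` cball 0 B)"
    by (intro compact_continuous_image bounded_linear.continuous_on[OF bounded_linear_scaleC_left]
        continuous_on_id compact_cball)
  show "blinfun_apply (HS_operator (\<lambda>(x, y). u x * v y)) ` cball 0 1 \<subseteq>
      (\<lambda>c. c *\<^sub>C abs_L2 v) ` cball 0 B"
    using c by (auto simp: eq)
qed

lemma compact_HS_operator_sum:
  assumes "finite I" "\<And>i. i \<in> I \<Longrightarrow> bounded_kernel (k i)" "\<And>i. i \<in> I \<Longrightarrow>
      HS_operator (k i) \<in> compact_operators"
  shows "HS_operator (\<lambda>p. \<Sum>i\<in>I. k i p) \<in> compact_operators"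
  using assms
proof (induction I rule: finite_induct)
  case empty
  then show ?case by (simp add: HS_operator_zero compact_operators_zero)
next
  case (insert i I)
  have "HS_operator (\<lambda>p. k i p + (\<Sum>i\<in>I. k i p)) = HS_operator (k i) + HS_operator (\<lambda>p. \<Sum>i\<in>I. k i p)"
    using insert.prems by (intro HS_operator_add square_integrable_bounded_kernel
        bounded_kernel_sum) auto
  moreover have "HS_operator (k i) + HS_operator (\<lambda>p. \<Sum>i\<in>I. k i p) \<in> compact_operators"
    using insert by (intro compact_operators_add) auto
  ultimately show ?case using insert.hyps by simp
qed


section \<open>Norm closability\<close>

text \<open>Such an operator multiplies by a function, and would be bounded below on functions that
  concentrate at one point. Precisely, let \<open>g = D f \<noteq> 0\<close> and compare the masses of \<open>g\<close> and \<open>f\<close> on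
  intervals: for small \<open>c > 0\<close> the additive interval function \<open>\<parallel>g\<parallel>\<^sup>2 - c\<^sup>2 \<parallel>f\<parallel>\<^sup>2\<close> is positive on the
  whole interval, hence by bisection also on arbitrarily short intervals near some point \<open>x\<close>. The
  normalised pieces of \<open>f\<close> on these intervals have images of norm at least \<open>c\<close>, supported closer
  and closer to \<open>x\<close>. By compactness the images accumulate at some \<open>h\<close> with \<open>\<parallel>h\<parallel> \<ge> c\<close>; but \<open>h\<close> is
  supported at the single point \<open>x\<close>, hence zero.\<close>

lemma compact_commuting_cutoff_eq_0:
  assumes D: "D \<in> compact_operators"
    and commute: "\<And>a b f. a \<le> b \<Longrightarrow> D (cutoff {a..<b} f) = cutoff {a..<b} (D f)"
  shows "D = 0"
proof (rule ccontr)
  assume "D \<noteq> 0"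
  then obtain f where "D f \<noteq> 0" by (metis blinfun_eqI zero_blinfun.rep_eq)
  define g where "g = D f"
  have g: "g \<noteq> 0" using \<open>D f \<noteq> 0\<close> by (simp add: g_def)
  then have f: "f \<noteq> 0" by (auto simp: g_def blinfun.zero_right)
  \<comment> \<open>Any positive constant below \<open>\<parallel>g\<parallel> / \<parallel>f\<parallel>\<close> makes the interval function positive in total.\<close>
  define c where "c = norm g / (2 * norm f)"
  have c: "c > 0" using f g by (simp add: c_def)
  define \<nu> where "\<nu> a b = (norm (cutoff {a..<b} g))\<^sup>2 - c\<^sup>2 * (norm (cutoff {a..<b} f))\<^sup>2"
      for a b :: real
  have \<nu>_add: "\<nu> a d = \<nu> a b + \<nu> b d" if "a \<le> b" "b \<le> d" for a b d
  proof -
    have "{a..<d} = {a..<b} \<union> {b..<d}" using that by auto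
    then show ?thesis
      unfolding \<nu>_def by (simp add: norm_cutoff_Un_power2 algebra_simps)
  qed
  have "AE x in unit_measure. x \<noteq> 1"
    by (rule AE_unit_neq)
  then have "AE x in unit_measure. x \<in> {0..<1}"
    using AE_space by eventually_elim (auto simp: space_restrict_space)
  then have "\<nu> 0 1 = (norm g)\<^sup>2 - c\<^sup>2 * (norm f)\<^sup>2"
    by (simp add: \<nu>_def cutoff_self)
  also have "\<dots> > 0"
    using f g by (simp add: c_def power_divide power_mult_distrib)
  finally have pos: "\<not> \<nu> 0 1 \<le> 0" by simp
  \<comment> \<open>Otherwise every point has short intervals around it of nonpositive mass only, and additivity
    makes the total mass nonpositive.\<close>
  obtain x where x: "\<And>d. d > 0 \<Longrightarrow> \<exists>a b. a \<le> x \<and> x \<le> b \<and> b - a < d \<and> \<nu> a b > 0"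
  proof (rule ccontr)
    assume *: "\<not> thesis"
    have "(0 :: real) \<le> 1" by simp
    then have "\<nu> 0 1 \<le> 0"
    proof (induction rule: Bolzano[where P = "\<lambda>a b. \<nu> a b \<le> 0"])
      case (local x)
      show ?case using that[of x] * by (meson not_le)
    next
      case (trans a b d)
      then show ?case using \<nu>_add[of a b d] by simp
    qed
    with pos show False by simp
  qed
  have "\<exists>a b. a \<le> x \<and> x \<le> b \<and> b - a < inverse (Suc n) \<and> \<nu> a b > 0" for n
    by (rule x) simp
  then obtain a b where ab: "\<And>n. a n \<le> x" "\<And>n. x \<le>
      b n" "\<And>n. b n - a n < inverse (Suc n)" "\<And>n. \<nu> (a n) (b n) > 0"
    by metis
  define J where "J n = {a n..<b n}" for n
  define u where "u n = (1 / norm (cutoff (J n) f)) *\<^sub>R cutoff (J n) f" for n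
  have DJ: "D (cutoff (J n) f) = cutoff (J n) g" for n
    using commute[of "a n" "b n" f] ab(1,2)[of n] by (simp add: J_def g_def)
  have nz: "cutoff (J n) f \<noteq> 0" for n
  proof
    assume "cutoff (J n) f = 0"
    moreover then have "cutoff (J n) g = 0" using DJ[of n] by (simp add: blinfun.zero_right)
    ultimately show False using ab(4)[of n] by (simp add: \<nu>_def J_def)
  qed
  have Du: "D (u n) = (1 / norm (cutoff (J n) f)) *\<^sub>R cutoff (J n) g" for n
    by (simp add: u_def blinfun.scaleR_right DJ)
  have lower: "c \<le> norm (D (u n))" for n
  proof -
    have "(c * norm (cutoff (J n) f))\<^sup>2 \<le> (norm (cutoff (J n) g))\<^sup>2"
      using ab(4)[of n] by (simp add: \<nu>_def J_def power_mult_distrib)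
    then have "c * norm (cutoff (J n) f) \<le> norm (cutoff (J n) g)"
      by (rule power2_le_imp_le) simp
    then show ?thesis using nz[of n] by (simp add: Du field_simps)
  qed
  have "D (u n) \<in> closure (blinfun_apply D ` cball 0 1)" for n
    using nz[of n] by (intro subsetD[OF closure_subset] imageI) (simp add: u_def)
  then obtain h r where r: "strict_mono (r :: nat \<Rightarrow> nat)" and lim: "(\<lambda>n. D (u (r n))) \<longlonglongrightarrow> h"
    using compact_operatorsD(2)[OF D, unfolded compact_def, rule_format, of "\<lambda>n. D (u n)"]
    by (auto simp: o_def)
  have "c \<le> norm h"
    by (rule LIMSEQ_le_const[OF tendsto_norm[OF lim]]) (use lower in auto)
  \<comment> \<open>From some index on, all pieces lie in the given window around \<open>x\<close>, and being fixed by the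
    cutoff to this window is preserved in the limit.\<close>
  have supp: "cutoff {x - inverse (Suc m)..<x + inverse (Suc m)} h = h" for m
  proof -
    define I where "I = {x - inverse (Suc m)..<x + inverse (Suc m)}"
    have I: "I \<in> sets borel" by (simp add: I_def)
    have ev: "cutoff I (D (u (r n))) = D (u (r n))" if "n \<ge> m" for n
    proof -
      have "m \<le> r n" using seq_suble[OF r, of n] that by linarith
      then have "inverse (Suc (r n)) \<le> inverse (real (Suc m))"
        by (intro le_imp_inverse_le) auto
      then have "I \<inter> J (r n) = J (r n)"
        using ab(1-3)[of "r n"] unfolding I_def J_def
        by (intro Int_absorb1 subsetI, unfold atLeastLessThan_iff) linarith
      then show ?thesis
        using cutoff_cutoff[of I "J (r n)" g] I
        by (simp add: Du linear_scale[OF bounded_linear.linear[OF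
            bounded_linear_cutoff[OF I]]] J_def)
    qed
    have "(\<lambda>n. cutoff I (D (u (r n)))) \<longlonglongrightarrow> cutoff I h"
      by (rule bounded_linear.tendsto[OF bounded_linear_cutoff[OF I] lim])
    then have "(\<lambda>n. D (u (r n))) \<longlonglongrightarrow> cutoff I h"
      by (rule Lim_transform_eventually) (use ev in \<open>auto simp: eventually_sequentially\<close>)
    then have "h = cutoff I h"
      by (rule LIMSEQ_unique[OF lim])
    then show ?thesis
      by (simp only: I_def[symmetric])
  qed
  have "AE y in unit_measure. \<forall>m. rep_L2 h y =
      indicator {x - inverse (Suc m)..<x + inverse (Suc m)} y * rep_L2 h y"
    unfolding AE_all_countable
  proof
    show "AE y in unit_measure. rep_L2 h y =
        indicator {x - inverse (Suc m)..<x + inverse (Suc m)} y * rep_L2 h y" for m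
      using AE_rep_cutoff[of "{x - inverse (Suc m)..<x + inverse (Suc m)}" h] unfolding supp by simp
  qed
  moreover have "AE y in unit_measure. y \<noteq> x" by (rule AE_unit_neq)
  ultimately have "AE y in unit_measure. rep_L2 h y = rep_L2 0 y"
    using rep_L2_0
  proof eventually_elim
    case (elim y)
    obtain m where "inverse (Suc m) < \<bar>y - x\<bar>"
      using elim(2) reals_Archimedean[of "\<bar>y - x\<bar>"] by auto
    then have "y \<notin> {x - inverse (Suc m)..<x + inverse (Suc m)}" by auto
    then have "rep_L2 h y = 0" using elim(1) by (metis indicator_simps(2) mult_zero_left)
    then show ?case using elim(3) by simp
  qed
  then have "h = 0" by (rule L2_eqI)
  with \<open>c \<le> norm h\<close> c show False by simp
qed

text \<open>The rectangle \<open>{x < t \<le> y}\<close> lies inside the triangle and the rectangle \<open>{y < t \<le> x}\<close> outside. This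
  is all that is left of the definition of the triangle when passing to norm limits.\<close>

lemma cutoff_triangular_truncation:
  fixes t :: real and k :: "real \<times> real \<Rightarrow> complex"
  assumes k: "square_integrable square_measure k" 
    and \<phi>k: "square_integrable square_measure (\<lambda>p. \<phi> p * k p)"
    and \<phi>: "\<phi> = indicator {(x, y). x \<in> {0..1} \<and> y \<in> {0..1} \<and> x < y}"
  shows "cutoff {t..} (HS_operator (\<lambda>p. \<phi> p * k p) (cutoff {..<t} f)) =
      cutoff {t..} (HS_operator k (cutoff {..<t} f))"
    and "cutoff {..<t} (HS_operator (\<lambda>p. \<phi> p * k p) (cutoff {t..} f)) = 0"
proof -
  note cutoff = cutoff_HS_operator_cutoff[of "{..<t}" "{t..}"] cutoff_HS_operator_cutoff[of
      "{t..}" "{..<t}"]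
  have "HS_operator (\<lambda>p. indicator {..<t} (fst p) * indicator {t..} (snd p) * (\<phi> p * k p)) =
    HS_operator (\<lambda>p. indicator {..<t} (fst p) * indicator {t..} (snd p) * k p)"
    by (rule HS_operator_cong[OF cutoff(2)[OF _ _ \<phi>k] cutoff(2)[OF _ _ k]])
      (auto simp: \<phi> space_square_measure indicator_def intro!: AE_I2)
  then show "cutoff {t..} (HS_operator (\<lambda>p. \<phi> p * k p) (cutoff {..<t} f)) =
      cutoff {t..} (HS_operator k (cutoff {..<t} f))"
    by (simp add: cutoff k \<phi>k)
  have "HS_operator (\<lambda>p. indicator {t..} (fst p) * indicator {..<t} (snd p) * (\<phi> p * k p)) =
    HS_operator (\<lambda>p. 0 * k p)"
    by (rule HS_operator_cong[OF cutoff(4)[OF _ _ \<phi>k] square_integrable_cmult[OF k]])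
      (auto simp: \<phi> indicator_def intro!: AE_I2)
  also have "\<dots> = 0"
    by (simp only: HS_operator_scaleC[OF k] scaleC_zero)
  finally show "cutoff {..<t} (HS_operator (\<lambda>p. \<phi> p * k p) (cutoff {t..} f)) = 0"
    by (simp add: cutoff k \<phi>k)
qed

text \<open>Both rectangle conditions are norm closed. Hence two limits \<open>S1\<close>, \<open>S2\<close> over the same \<open>T\<close> agree on
  all these rectangles, which means that the compact operator \<open>S1 - S2\<close> commutes with the cutoffs to
  half-lines.\<close>

lemma closable_triangular_truncation:
  assumes \<phi>: "\<phi> = indicator {(x, y). x \<in> {0..1} \<and> y \<in> {0..1} \<and> x < y}"
  shows "closable_multiplier \<phi>"
proof -
  define Q where "Q t f = {p :: (L2 \<Rightarrow>\<^sub>L L2) \<times> (L2 \<Rightarrow>\<^sub>L L2).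
    cutoff {t..} (blinfun_apply (snd p) (cutoff {..<t} f)) = cutoff {t..} (blinfun_apply (fst p)
        (cutoff {..<t} f)) \<and>
    cutoff {..<t} (blinfun_apply (snd p) (cutoff {t..} f)) = 0}" for t f
  have cont: "continuous_on UNIV (\<lambda>p :: (L2 \<Rightarrow>\<^sub>L L2) \<times> (L2 \<Rightarrow>\<^sub>L L2). cutoff A (blinfun_apply
      (snd p) f))"
    "continuous_on UNIV (\<lambda>p :: (L2 \<Rightarrow>\<^sub>L L2) \<times> (L2 \<Rightarrow>\<^sub>L L2). cutoff A (blinfun_apply (fst p) f))"
        if "A \<in> sets borel" for A f
    by (intro bounded_linear.continuous_on[OF bounded_linear_cutoff[OF that]] continuous_intros)+
  have Q: "closed (Q t f)" for t f
    unfolding Q_def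
    by (intro closed_Collect_conj closed_Collect_eq cont continuous_on_const) auto
  have "multiplier_graph \<phi> \<subseteq> Q t f" for t f
    using cutoff_triangular_truncation[OF _ _ \<phi>]
        by (auto simp: multiplier_graph_def multiplier_domain_def Q_def)
  then have closure: "closure (multiplier_graph \<phi>) \<subseteq> Q t f" for t f
    by (intro closure_minimal Q)
  show ?thesis
    unfolding closable_multiplier_def closable_def single_valued_def
  proof (intro allI impI)
    fix T S1 S2
    let ?X = "top_of_set (compact_operators \<times> compact_operators) closure_of multiplier_graph \<phi>"
    assume "(T, S1) \<in> ?X" "(T, S2) \<in> ?X"
    then have S: "S1 \<in> compact_operators" "S2 \<in> compact_operators"
      and mem: "(T, S1) \<in> closure (multiplier_graph \<phi>)" "(T, S2) \<in> closure (multiplier_graph \<phi>)"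
      by (auto simp: closure_of_subtopology euclidean_closure_of dest: subsetD[OF closure_mono[OF
          Int_lower2]])
    define D where "D = S1 - S2"
    have lin: "cutoff A (f - g) = cutoff A f - cutoff A g" if "A \<in> sets borel" for A f g
      by (rule linear_diff[OF bounded_linear.linear[OF bounded_linear_cutoff[OF that]]])
    have D0: "cutoff {t..} (D (cutoff {..<t} f)) =
        0" "cutoff {..<t} (D (cutoff {t..} f)) = 0" for t f
      using subsetD[OF closure mem(1), of t f] subsetD[OF closure mem(2), of t f]
      by (auto simp: D_def Q_def blinfun.diff_left lin)
    have split: "f = cutoff {..<t} f + cutoff {t..} f" for f and t :: real
    proof -
      have "{..<t} \<union> {t..} = UNIV" "{..<t} \<inter> {t..} = {}" by auto
      then show ?thesis
        using cutoff_Un[of "{..<t}" "{t..}" f] cutoff_self[of UNIV f] by simp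
    qed
    have add: "cutoff A (f + g) = cutoff A f + cutoff A g" if "A \<in> sets borel" for A f g
      by (rule linear_add[OF bounded_linear.linear[OF bounded_linear_cutoff[OF that]]])
    \<comment> \<open>Both off-diagonal corners of the block decomposition of \<open>D\<close> at \<open>t\<close> vanish.\<close>
    have lower: "D (cutoff {..<t} f) = cutoff {..<t} (D f)" for t f
    proof -
      have "D (cutoff {..<t} f) = cutoff {..<t} (D (cutoff {..<t} f)) +
          cutoff {t..} (D (cutoff {..<t} f))"
        by (rule split)
      also have "\<dots> = cutoff {..<t} (D (cutoff {..<t} f)) + cutoff {..<t} (D (cutoff {t..} f))"
        by (simp only: D0)
      also have "\<dots> = cutoff {..<t} (D (cutoff {..<t} f + cutoff {t..} f))"
        by (simp add: add blinfun.add_right)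
      also have "\<dots> = cutoff {..<t} (D f)"
        by (simp only: split[of f t, symmetric])
      finally show ?thesis .
    qed
    have upper: "D (cutoff {t..} f) = cutoff {t..} (D f)" for t f
    proof -
      have "D (cutoff {..<t} f) + D (cutoff {t..} f) = D f"
        by (simp only: blinfun.add_right[symmetric] split[of f t, symmetric])
      also have "\<dots> = cutoff {..<t} (D f) + cutoff {t..} (D f)"
        by (rule split)
      finally show ?thesis by (simp add: lower)
    qed
    have "D = 0"
    proof (rule compact_commuting_cutoff_eq_0)
      show "D \<in> compact_operators" unfolding D_def by (rule compact_operators_diff[OF S])
      fix a b :: real and f
      have "{a..<b} = {a..} \<inter> {..<b}" by auto
      then show "D (cutoff {a..<b} f) = cutoff {a..<b} (D f)"
        by (simp add: lower upper flip: cutoff_cutoff)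
    qed
    then show "S1 = S2" by (simp add: D_def)
  qed
qed


section \<open>Weak* cluster points in the bidual\<close>

text \<open>Tychonoff's theorem, in terms of filters: a pointwise bounded sequence of functions converges
  pointwise along some filter finer than that of the cofinite sets. A subsequence would not do, as
  the index type may be uncountable.\<close>

lemma limit_along_filter:
  fixes b :: "nat \<Rightarrow> 'i \<Rightarrow> complex"
  assumes bd: "\<And>n i. norm (b n i) \<le> B i"
  obtains \<F> l where "\<F> \<noteq> bot" "\<F> \<le> sequentially" "\<And>i. ((\<lambda>n. b n i) \<longlongrightarrow> l i) \<F>"
proof -
  have "compact (PiE UNIV (\<lambda>i. cball (0::complex) (B i)))"
    using compactin_PiE[of "\<lambda>_. euclidean :: complex topology" UNIV "\<lambda>i. cball (0::complex) (B i)"]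
    by (simp add: euclidean_product_topology)
  moreover have "eventually (\<lambda>g. g \<in> PiE UNIV (\<lambda>i. cball (0::complex) (B i))) (filtermap b
      sequentially)"
    unfolding eventually_filtermap using bd by (intro always_eventually) (auto simp: PiE_def)
  ultimately obtain l where l: "inf (nhds l) (filtermap b sequentially) \<noteq> bot"
    unfolding compact_filter by (meson filtermap_bot_iff sequentially_bot)
  \<comment> \<open>This filter forces the sequence into every neighbourhood of the cluster point \<open>l\<close>.\<close>
  define \<F> where "\<F> = inf (filtercomap b (nhds l)) sequentially"
  have "\<F> \<noteq> bot"
  proof
    assume "\<F> = bot"
    then obtain P Q where P: "eventually P (nhds l)" and Q: "eventually Q sequentially"
        and PQ: "\<And>n. P (b n) \<Longrightarrow> Q n \<Longrightarrow> False"
      unfolding \<F>_def trivial_limit_def eventually_inf eventually_filtercomap by metis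
    have "eventually (\<lambda>g. \<not> P g) (filtermap b sequentially)"
      unfolding eventually_filtermap using Q by (rule eventually_mono) (use PQ in blast)
    with P have "eventually (\<lambda>g. False) (inf (nhds l) (filtermap b sequentially))"
      unfolding eventually_inf by blast
    with l show False by (simp add: trivial_limit_def)
  qed
  moreover have "\<F> \<le> sequentially" by (simp add: \<F>_def)
  moreover have "((\<lambda>n. b n i) \<longlongrightarrow> l i) \<F>" for i
  proof -
    have "filterlim b (nhds l) \<F>"
      unfolding \<F>_def filterlim_def by (metis filtermap_filtercomap filtermap_mono inf_le1
          order_trans)
    then show ?thesis
      using continuous_on_tendsto_compose[OF continuous_on_product_coordinates[of i], of b
          l \<F>] by simp
  qed
  ultimately show thesis by (rule that)
qed

lemma limitin_imp_closure_of:
  assumes lim: "limitin X f l F" and ev: "eventually (\<lambda>x. f x \<in> S) F" and F: "F \<noteq> bot"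
  shows "l \<in> X closure_of S"
  unfolding in_closure_of
proof (intro conjI allI impI)
  show "l \<in> topspace X" using lim by (rule limitin_topspace)
  fix U assume "l \<in> U \<and> openin X U"
  then have "eventually (\<lambda>x. f x \<in> U) F" using lim by (simp add: limitin_def)
  with ev have "eventually (\<lambda>x. f x \<in> S \<and> f x \<in> U) F" by (rule eventually_conj)
  then show "\<exists>y. y \<in> S \<and> y \<in> U" using eventually_happens'[OF F] by blast
qed

text \<open>Without these closure properties, sums and multiples of restricted functionals need not be
  functionals, and the embedding into the bidual could leave the bidual.\<close>

locale complex_subspace =
  fixes X :: "'a::complex_normed_vector set"
  assumes zero: "0 \<in> X"
    and add: "x \<in> X \<Longrightarrow> y \<in> X \<Longrightarrow> x + y \<in> X"
    and scaleC: "x \<in> X \<Longrightarrow> c *\<^sub>C x \<in> X"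
begin

lemma dual_zero:
  assumes f: "f \<in> dual X" shows "f 0 = 0"
proof -
  have "f (0 *\<^sub>C 0) = 0 * f 0"
    using f zero unfolding dual_def by blast
  moreover have "0 *\<^sub>C (0 :: 'a) = 0"
    using scaleC_of_real[of 0 "0 :: 'a"] by simp
  ultimately show ?thesis by simp
qed

lemma dual_norm_upper:
  assumes f: "f \<in> dual X" and y: "y \<in> X" "norm y \<le> 1"
  shows "norm (f y) \<le> dual_norm X f"
proof -
  obtain B where B: "\<And>x. x \<in> X \<Longrightarrow> norm (f x) \<le> B * norm x"
    using f unfolding dual_def by blast
  have "bdd_above ((\<lambda>x. norm (f x)) ` {x \<in> X. norm x \<le> 1})"
  proof (rule bdd_aboveI2)
    fix x assume "x \<in> {x \<in> X. norm x \<le> 1}"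
    then have "norm (f x) \<le> B * norm x" "norm x \<le> 1" using B by auto
    moreover have "B * norm x \<le> \<bar>B\<bar> * 1"
      using \<open>norm x \<le> 1\<close> by (intro mult_mono) auto
    ultimately show "norm (f x) \<le> \<bar>B\<bar>" by simp
  qed
  then show ?thesis
    unfolding dual_norm_def using y by (intro cSUP_upper) auto
qed

lemma dual_norm_nonneg: "f \<in> dual X \<Longrightarrow> 0 \<le> dual_norm X f"
  using dual_norm_upper[of f 0] zero by (simp add: dual_zero)

lemma norm_dual_le:
  assumes f: "f \<in> dual X" and x: "x \<in> X"
  shows "norm (f x) \<le> dual_norm X f * norm x"
proof (cases "x = 0")
  case True
  then show ?thesis by (simp add: dual_zero[OF f])
next
  case False
  define y where "y = complex_of_real (1 / norm x) *\<^sub>C x"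
  have "y \<in> X" "norm y \<le> 1"
    unfolding y_def norm_scaleC using False scaleC[OF x] by (auto simp: norm_divide)
  then have "norm (f y) \<le> dual_norm X f"
    by (rule dual_norm_upper[OF f])
  moreover have "f y = complex_of_real (1 / norm x) * f x"
    using f x unfolding y_def dual_def by blast
  ultimately show ?thesis
    using False by (simp add: norm_mult norm_divide field_simps)
qed

lemma dual_sum:
  assumes f: "f \<in> dual X" and g: "g \<in> dual X"
  shows "(\<lambda>x\<in>X. f x + g x) \<in> dual X"
proof -
  obtain B where B: "\<And>x. x \<in> X \<Longrightarrow> norm (f x) \<le> B * norm x"
    using f unfolding dual_def by blast
  obtain C where C: "\<And>x. x \<in> X \<Longrightarrow> norm (g x) \<le> C * norm x"
    using g unfolding dual_def by blast
  have "norm (f x + g x) \<le> (B + C) * norm x" if "x \<in> X" for x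
    using norm_triangle_ineq[of "f x" "g x"] B[OF that] C[OF that] by (simp add: distrib_right)
  then have "\<exists>K. \<forall>x\<in>X. norm (f x + g x) \<le> K * norm x" by blast
  then show ?thesis
    using f g by (simp add: dual_def add scaleC distrib_left)
qed

lemma dual_scale:
  assumes f: "f \<in> dual X"
  shows "(\<lambda>x\<in>X. c * f x) \<in> dual X"
proof -
  obtain B where B: "\<And>x. x \<in> X \<Longrightarrow> norm (f x) \<le> B * norm x"
    using f unfolding dual_def by blast
  have "norm (c * f x) \<le> (norm c * B) * norm x" if "x \<in> X" for x
    using B[OF that] by (simp add: norm_mult mult_left_mono mult.assoc)
  then have "\<exists>K. \<forall>x\<in>X. norm (c * f x) \<le> K * norm x" by blast
  then show ?thesis
    using f by (simp add: dual_def add scaleC distrib_left mult.left_commute)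
qed

lemma bidual_embedding_in_bidual:
  assumes x: "x \<in> X" shows "bidual_embedding X x \<in> bidual X"
proof -
  have "\<forall>f\<in>dual X. norm (f x) \<le> norm x * dual_norm X f"
    using norm_dual_le[OF _ x] by (simp add: mult.commute)
  then show ?thesis
    using x unfolding bidual_def bidual_embedding_def by (auto simp: dual_sum dual_scale)
qed

lemma limitin_weak_star_topology:
  assumes F: "F \<in> bidual X" and x: "\<And>n. x n \<in> X"
    and lim: "\<And>f. f \<in> dual X \<Longrightarrow> ((\<lambda>n. f (x n)) \<longlongrightarrow> F f) \<F>"
  shows "limitin (weak_star_topology X) (\<lambda>n. bidual_embedding X (x n)) F \<F>"
  unfolding weak_star_topology_def limitin_subtopology limitin_componentwise
proof (intro conjI ballI always_eventually allI)
  show "F \<in> extensional (dual X)" using F by (simp add: bidual_def)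
  show "bidual_embedding X (x n) \<in> topspace (product_topology (\<lambda>_. euclidean) (dual X))" for n
    by (simp add: bidual_embedding_def)
  show "limitin euclidean (\<lambda>n. bidual_embedding X (x n) f) (F f) \<F>" if "f \<in> dual X" for f
    using lim[OF that] that by (simp add: bidual_embedding_def)
qed (fact F, rule bidual_embedding_in_bidual[OF x])

text \<open>Sequential form of the Banach--Alaoglu theorem, with the limit taken along a filter. Linearity
  and boundedness pass to the limit functional pointwise.\<close>

lemma bounded_seq_cluster_point:
  assumes x: "\<And>n. x n \<in> X" and bd: "\<And>n. norm (x n) \<le> B"
  obtains \<F> F where "\<F> \<noteq> bot" "\<F> \<le> sequentially"
    "limitin (weak_star_topology X) (\<lambda>n::nat. bidual_embedding X (x n)) F \<F>"
    "\<And>f. f \<in> dual X \<Longrightarrow> ((\<lambda>n. f (x n)) \<longlongrightarrow> F f) \<F>"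
proof -
  \<comment> \<open>Tychonoff's theorem is applied on the whole function type; outside the dual the embedding
    has the constant value \<open>undefined\<close>.\<close>
  have "norm (bidual_embedding X (x n) f) \<le>
      (if f \<in> dual X then B * dual_norm X f else norm (undefined :: complex))" for n f
  proof (cases "f \<in> dual X")
    case True
    have "norm (f (x n)) \<le> dual_norm X f * norm (x n)" by (rule norm_dual_le[OF True x])
    also have "\<dots> \<le> dual_norm X f * B" by (intro mult_left_mono bd dual_norm_nonneg True)
    finally show ?thesis using True by (simp add: bidual_embedding_def mult.commute)
  qed (simp add: bidual_embedding_def)
  then obtain \<F> l where \<F>: "\<F> \<noteq> bot" "\<F> \<le> sequentially"
    and l: "\<And>f. ((\<lambda>n. bidual_embedding X (x n) f) \<longlongrightarrow> l f) \<F>"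
    by (rule limit_along_filter[of "\<lambda>n. bidual_embedding X (x n)"]) (rule that)
  define F where "F = restrict l (dual X)"
  have lim: "((\<lambda>n. f (x n)) \<longlongrightarrow> F f) \<F>" if "f \<in> dual X" for f
    using l[of f] that by (simp add: F_def bidual_embedding_def)
  have "F \<in> bidual X"
    unfolding bidual_def
  proof (intro CollectI conjI ballI allI)
    show "F \<in> extensional (dual X)" by (simp add: F_def)
  next
    fix f g assume fg: "f \<in> dual X" "g \<in> dual X"
    have "((\<lambda>n. f (x n) + g (x n)) \<longlongrightarrow> F (\<lambda>x\<in>X. f x + g x)) \<F>"
      using lim[OF dual_sum[OF fg]] x by simp
    then show "F (\<lambda>x\<in>X. f x + g x) = F f + F g"
      using tendsto_unique[OF \<F>(1)] tendsto_add[OF lim[OF fg(1)] lim[OF fg(2)]] by metis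
  next
    fix c f assume f: "f \<in> dual X"
    have "((\<lambda>n. c * f (x n)) \<longlongrightarrow> F (\<lambda>x\<in>X. c * f x)) \<F>"
      using lim[OF dual_scale[OF f, of c]] x by simp
    then show "F (\<lambda>x\<in>X. c * f x) = c * F f"
      using tendsto_unique[OF \<F>(1)] tendsto_mult_left[OF lim[OF f], of c] by metis
  next
    have "norm (F f) \<le> B * dual_norm X f" if f: "f \<in> dual X" for f
    proof (rule tendsto_upperbound[OF tendsto_norm[OF lim[OF f]] _ \<F>(1)])
      have "norm (f (x n)) \<le> B * dual_norm X f" for n
        using norm_dual_le[OF f x[of n]] mult_left_mono[OF bd[of n] dual_norm_nonneg[OF f]]
        by (simp add: mult.commute)
      then show "\<forall>\<^sub>F n in \<F>. norm (f (x n)) \<le> B * dual_norm X f" by simp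
    qed
    then show "\<exists>B. \<forall>f\<in>dual X. norm (F f) \<le> B * dual_norm X f" by blast
  qed
  then have "limitin (weak_star_topology X) (\<lambda>n. bidual_embedding X (x n)) F \<F>"
    using x lim by (rule limitin_weak_star_topology)
  with \<F> show thesis using lim by (rule that)
qed

text \<open>The graph contains \<open>(T n, S n)\<close> with \<open>T n\<close> tending to \<open>0\<close> in norm. A weak* cluster point \<open>F\<close> of the
  bounded sequence \<open>S n\<close> thus gives a point \<open>(0, F)\<close> of the closure, and \<open>f\<close> detects that \<open>F\<close> is not
  zero.\<close>

lemma not_weak_star_closableI:
  assumes G: "\<And>n::nat. (T n, S n) \<in> G" "(0, 0) \<in> G"
    and X: "\<And>n. T n \<in> X" "\<And>n. S n \<in> X"
    and T: "T \<longlonglongrightarrow> 0" and S: "\<And>n. norm (S n) \<le> B"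
    and f: "f \<in> dual X" and c: "c > 0" "\<And>n. c \<le> norm (f (S n))"
  shows "\<not> weak_star_closable X G"
proof
  let ?J = "bidual_embedding X"
  let ?W = "weak_star_topology X"
  let ?G = "map_prod ?J ?J ` G"
  assume closable: "weak_star_closable X G"
  obtain \<F> F where \<F>: "\<F> \<noteq> bot" "\<F> \<le> sequentially"
    and F: "limitin ?W (\<lambda>n. ?J (S n)) F \<F>" and lim: "\<And>f. f \<in> dual X \<Longrightarrow> ((\<lambda>n. f (S n)) \<longlongrightarrow> F f) \<F>"
    by (rule bounded_seq_cluster_point[of S B, OF X(2) S]) (rule that)
  have "(\<lambda>n. f (T n)) \<longlonglongrightarrow> f 0" if f: "f \<in> dual X" for f
  proof -
    have "(\<lambda>n. dual_norm X f * norm (T n)) \<longlonglongrightarrow> 0"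
      using tendsto_mult_left[OF tendsto_norm_zero[OF T], of "dual_norm X f"] by simp
    then have "(\<lambda>n. f (T n)) \<longlonglongrightarrow> 0"
      by (rule Lim_null_comparison[rotated]) (use norm_dual_le[OF f X(1)] in simp)
    then show ?thesis by (simp add: dual_zero[OF f])
  qed
  then have T0: "limitin ?W (\<lambda>n. ?J (T n)) (?J 0) \<F>"
    by (intro limitin_weak_star_topology bidual_embedding_in_bidual zero X(1))
      (simp add: bidual_embedding_def tendsto_mono[OF \<F>(2)])
  have "limitin (prod_topology ?W ?W) (\<lambda>n. (?J (T n), ?J (S n))) (?J 0, F) \<F>"
    using T0 F by (simp add: limitin_pairwise o_def)
  moreover have "\<forall>\<^sub>F n in \<F>. (?J (T n), ?J (S n)) \<in> ?G"
    using G(1) by (intro always_eventually) force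
  ultimately have 1: "(?J 0, F) \<in> prod_topology ?W ?W closure_of ?G"
    using \<F>(1) by (rule limitin_imp_closure_of)
  have J0: "?J 0 \<in> topspace ?W"
    using zero by (simp add: weak_star_topology_def bidual_embedding_in_bidual)
      (simp add: bidual_embedding_def)
  have "(?J 0, ?J 0) \<in> ?G" using G(2) by force
  with J0 have "(?J 0, ?J 0) \<in> topspace (prod_topology ?W ?W) \<inter> ?G" by simp
  then have "(?J 0, ?J 0) \<in> prod_topology ?W ?W closure_of ?G"
    by (rule subsetD[OF closure_of_subset_Int])
  with 1 closable have "F = ?J 0"
    unfolding weak_star_closable_def single_valued_def by blast
  then have "F f = 0" using f by (simp add: bidual_embedding_def dual_zero)
  moreover have "c \<le> norm (F f)"
    by (rule tendsto_lowerbound[OF tendsto_norm[OF lim[OF f]] _ \<F>(1)]) (simp add: c)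
  ultimately show False using c(1) by simp
qed

end

interpretation compact_operators: complex_subspace compact_operators
  by unfold_locales (fact compact_operators_zero compact_operators_add compact_operators_scaleC)+


section \<open>Dyadic averages and Rademacher functions\<close>

text \<open>The number of the dyadic interval of length \<open>2\<^sup>-\<^sup>j\<close> that contains \<open>x\<close>. The point \<open>1\<close> forms a cell of
  its own, of measure zero.\<close>

definition dyadic_cell :: "nat \<Rightarrow> real \<Rightarrow> int"
  where "dyadic_cell j x = \<lfloor>2 ^ j * x\<rfloor>"

text \<open>The sign is that of the half of its level \<open>j\<close> cell in which \<open>x\<close> lies: negative on left halves,
  which are the cells of even number on the next level.\<close>

definition rademacher :: "nat \<Rightarrow> real \<Rightarrow> real"
  where "rademacher j x = (if even (dyadic_cell (Suc j) x) then -1 else 1)"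

text \<open>The kernel of the conditional expectation onto the functions that are constant on the cells of
  level \<open>j\<close>.\<close>

definition averaging :: "nat \<Rightarrow> real \<Rightarrow> real \<Rightarrow> real"
  where "averaging j x y = (if dyadic_cell j x = dyadic_cell j y then 2 ^ j else 0)"

lemma measurable_dyadic_cell: "dyadic_cell j \<in> measurable borel (count_space UNIV)"
  unfolding dyadic_cell_def by measurable

lemma measurable_dyadic_cell_unit [measurable]: "dyadic_cell j \<in>
    measurable unit_measure (count_space UNIV)"
  using measurable_dyadic_cell[of j] by (intro measurable_restrict_space1) simp

lemma measurable_rademacher [measurable]: "rademacher j \<in> borel_measurable unit_measure"
  unfolding rademacher_def by measurable

lemma measurable_averaging [measurable]:
  assumes [measurable]: "f \<in> measurable M unit_measure" "g \<in> measurable M unit_measure"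
  shows "(\<lambda>p. averaging j (f p) (g p)) \<in> borel_measurable M"
  unfolding averaging_def by measurable

lemma measurable_averaging_const [measurable]:
  "(\<lambda>y. averaging j x y) \<in> borel_measurable unit_measure" "(\<lambda>x. averaging j x y) \<in>
      borel_measurable unit_measure"
  unfolding averaging_def by measurable

lemma dyadic_cell_div: "dyadic_cell (i + d) x div 2 ^ d = dyadic_cell i x"
proof -
  have "\<lfloor>2 ^ (i + d) * x / real_of_int (2 ^ d)\<rfloor> = \<lfloor>2 ^ (i + d) * x\<rfloor> div 2 ^ d"
    by (rule floor_divide_real_eq_div) simp
  moreover have "2 ^ (i + d) * x / real_of_int (2 ^ d) = 2 ^ i * x"
    by (simp add: power_add)
  ultimately show ?thesis by (simp add: dyadic_cell_def)
qed

lemma dyadic_cell_eq_refine: "dyadic_cell j x = dyadic_cell j y \<Longrightarrow> i \<le> j \<Longrightarrow> dyadic_cell i x =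
    dyadic_cell i y"
  by (metis dyadic_cell_div le_Suc_ex)

lemma dyadic_cell_Suc_div_2: "dyadic_cell (Suc j) x div 2 = dyadic_cell j x"
  using dyadic_cell_div[of j 1 x] by simp

lemma dyadic_cell_unit: "x \<in> {0..1} \<Longrightarrow> dyadic_cell j x \<in> {0..2 ^ j}"
proof -
  assume x: "x \<in> {0..1}"
  then have "2 ^ j * x \<le> 2 ^ j * 1" by (intro mult_left_mono) auto
  then have "\<lfloor>2 ^ j * x\<rfloor> \<le> \<lfloor>2 ^ j * 1 :: real\<rfloor>" by (rule floor_mono)
  also have "\<dots> = 2 ^ j" by (metis floor_of_int mult.right_neutral of_int_numeral of_int_power)
  finally show ?thesis using x by (simp add: dyadic_cell_def)
qed

lemma averaging_sym: "averaging j x y = averaging j y x"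
  by (auto simp: averaging_def)

lemma averaging_nonneg: "0 \<le> averaging j x y"
  by (simp add: averaging_def)

lemma averaging_le: "averaging j x y \<le> 2 ^ j"
  by (simp add: averaging_def)

lemma abs_rademacher: "\<bar>rademacher j x\<bar> = 1"
  by (simp add: rademacher_def)

lemma abs_one_plus_rademacher: "\<bar>1 + rademacher j x\<bar> \<le> 2" "\<bar>1 - rademacher j x\<bar> \<le> 2"
  by (simp_all add: rademacher_def)

text \<open>The value for other \<open>c\<close> includes \<open>c = 2\<^sup>j\<close>, the cell of the point \<open>1\<close>.\<close>

lemma measure_dyadic_cell:
  "measure unit_measure {x \<in> space unit_measure. dyadic_cell j x = c} = (if 0 \<le> c \<and>
      c < 2 ^ j then 1 / 2 ^ j else 0)"
proof -
  let ?I = "{real_of_int c / 2 ^ j..<(real_of_int c + 1) / 2 ^ j}"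
  have "dyadic_cell j x = c \<longleftrightarrow> x \<in> ?I" for x
    unfolding dyadic_cell_def floor_eq_iff atLeastLessThan_iff
    by (simp add: pos_divide_le_eq pos_less_divide_eq mult.commute)
  moreover have "space unit_measure = {0..1}"
    by (simp add: space_restrict_space)
  ultimately have "{x \<in> space unit_measure. dyadic_cell j x = c} = {0..1} \<inter> ?I"
    by blast
  then have eq: "measure unit_measure {x \<in> space unit_measure. dyadic_cell j x = c} =
      measure lborel ({0..1} \<inter> ?I)"
    by (simp add: measure_restrict_space)
  consider "c < 0" | "0 \<le> c" "c < 2 ^ j" | "2 ^ j \<le> c" by linarith
  then show ?thesis
  proof cases
    case 1
    then have "(real_of_int c + 1) / 2 ^ j \<le> 0" by (simp add: divide_nonpos_pos)
    then have "{0..1} \<inter> ?I = {}" by auto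
    with 1 show ?thesis unfolding eq by simp
  next
    case 2
    then have "real_of_int (c + 1) \<le> real_of_int (2 ^ j)" by (intro of_int_le_iff[THEN iffD2]) simp
    then have "(of_int c + 1) / 2 ^ j \<le> (1 :: real)" by simp
    moreover have "0 \<le> real_of_int c / 2 ^ j" using 2 by simp
    ultimately have "{0..1} \<inter> ?I = ?I"
      by (intro Int_absorb1 subsetI, unfold atLeastLessThan_iff atLeastAtMost_iff) linarith
    moreover have "measure lborel ?I = 1 / 2 ^ j"
      by (simp add: measure_def divide_right_mono flip: diff_divide_distrib)
    ultimately show ?thesis unfolding eq using 2 by simp
  next
    case 3
    then have "real_of_int (2 ^ j) \<le> real_of_int c" by (intro of_int_le_iff[THEN iffD2])
    then have "1 \<le> real_of_int c / 2 ^ j" by simp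
    then have "{0..1} \<inter> ?I \<subseteq> {1}"
      by (intro subsetI, unfold Int_iff atLeastLessThan_iff atLeastAtMost_iff
          singleton_iff) linarith
    then have "emeasure lborel ({0..1} \<inter> ?I) \<le> emeasure lborel {1 :: real}"
      by (intro emeasure_mono) auto
    then have "measure lborel ({0..1} \<inter> ?I) = 0" by (simp add: measure_def)
    with 3 show ?thesis unfolding eq by simp
  qed
qed

lemma integral_dyadic_cell:
  "(\<integral>x. of_bool (dyadic_cell j x = c) \<partial>unit_measure) = (if 0 \<le> c \<and>
      c < 2 ^ j then 1 / 2 ^ j else (0 :: real))"
proof -
  have "(\<integral>x. of_bool (dyadic_cell j x = c) \<partial>unit_measure) =
      (\<integral>x. indicator {x \<in> space unit_measure. dyadic_cell j x = c} x \<partial>unit_measure :: real)"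
    by (intro Bochner_Integration.integral_cong) (auto simp: indicator_def)
  also have "\<dots> = measure unit_measure {x \<in> space unit_measure. dyadic_cell j x = c}"
    unfolding Bochner_Integration.integral_indicator
    by (intro arg_cong[where f = "measure unit_measure"]) auto
  finally show ?thesis by (simp only: measure_dyadic_cell)
qed

lemma integrable_bounded_unit:
  fixes f :: "real \<Rightarrow> real"
  assumes "f \<in> borel_measurable unit_measure" "\<And>x. \<bar>f x\<bar> \<le> B"
  shows "integrable unit_measure f"
  using assms by (intro unit_interval.integrable_const_bound[of _ B]) auto

lemma integrable_averaging: 
  "integrable unit_measure (\<lambda>x. averaging j x y)" "integrable unit_measure (\<lambda>y. averaging j x y)"
  by (auto intro!: integrable_bounded_unit[of _ "2 ^ j"] simp: averaging_nonneg averaging_le)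

lemma integral_averaging:
  shows "(\<integral>x. averaging j x y \<partial>unit_measure) = (if 0 \<le> dyadic_cell j y \<and>
      dyadic_cell j y < 2 ^ j then 1 else 0)"
proof -
  have "(\<integral>x. averaging j x y \<partial>unit_measure) = (\<integral>x. 2 ^ j * of_bool (dyadic_cell j x =
      dyadic_cell j y) \<partial>unit_measure)"
    by (intro Bochner_Integration.integral_cong) (auto simp: averaging_def)
  then show ?thesis by (simp add: integral_dyadic_cell)
qed

lemma integral_averaging_le: "(\<integral>x. averaging j x y \<partial>unit_measure) \<le> 1"
  by (simp add: integral_averaging)

lemma integral_averaging_le': "(\<integral>y. averaging j x y \<partial>unit_measure) \<le> 1"
  using integral_averaging_le[of j x] by (simp add: averaging_sym)

text \<open>The two halves of a cell have equal measure.\<close>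

lemma integral_rademacher_averaging: "(\<integral>x. rademacher j x * averaging j x y \<partial>unit_measure) = 0"
proof -
  let ?c = "dyadic_cell j y"
  have int: "integrable unit_measure (\<lambda>x. of_bool (dyadic_cell (Suc j) x = c) :: real)" for c
    by (rule integrable_bounded_unit[of _ 1]) auto
  have "rademacher j x * averaging j x y =
      2 ^ j * (of_bool (dyadic_cell (Suc j) x = 2 * ?c + 1) - of_bool (dyadic_cell (Suc j) x = 2
          * ?c))" for x
  proof -
    have "dyadic_cell j x = ?c \<longleftrightarrow> dyadic_cell (Suc j) x = 2 * ?c \<or>
        dyadic_cell (Suc j) x = 2 * ?c + 1"
      unfolding dyadic_cell_Suc_div_2[of j x, symmetric] by presburger
    then show ?thesis by (auto simp: rademacher_def averaging_def)
  qed
  then have "(\<integral>x. rademacher j x * averaging j x y \<partial>unit_measure) =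
      2 ^ j * ((\<integral>x. of_bool (dyadic_cell (Suc j) x = 2 * ?c + 1) \<partial>unit_measure) -
        (\<integral>x. of_bool (dyadic_cell (Suc j) x = 2 * ?c) \<partial>unit_measure))"
    using int by simp
  also have "\<dots> = 0"
    unfolding integral_dyadic_cell power_Suc by auto
  finally show ?thesis .
qed

text \<open>On a cell of the finer level the coarser factor is constant, while the finer Rademacher function
  has mean zero.\<close>

lemma integral_rademacher_averaging_orthogonal:
  assumes "i \<noteq> j"
  shows "(\<integral>z. rademacher i z * averaging i x z * (rademacher j z * averaging j y z)
      \<partial>unit_measure) = 0"
proof -
  have less: "(\<integral>z. rademacher i z * averaging i x z * (rademacher j z * averaging j y z)
      \<partial>unit_measure) = 0" if "i < j" for i j x y
  proof -
    have "rademacher i z * averaging i x z * (rademacher j z * averaging j y z) =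
        rademacher i y * averaging i x y * (rademacher j z * averaging j z y)" for z
    proof (cases "dyadic_cell j z = dyadic_cell j y")
      case True
      then have "dyadic_cell (Suc i) z = dyadic_cell (Suc i) y" "dyadic_cell i z = dyadic_cell i y"
        using that by (auto intro: dyadic_cell_eq_refine)
      then show ?thesis by (simp add: rademacher_def averaging_def)
    qed (simp add: averaging_def)
    then show ?thesis
      by (simp only: integral_mult_right_zero integral_rademacher_averaging mult_zero_right)
  qed
  show ?thesis
  proof (cases "i < j")
    case True
    then show ?thesis by (rule less)
  next
    case False
    with assms have "j < i" by simp
    from less[OF this, of y x] show ?thesis by (simp add: mult_ac)
  qed
qed

lemma square_integrable_bounded_unit:
  assumes "u \<in> borel_measurable unit_measure" "\<And>x. \<bar>u x\<bar> \<le> B"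
  shows "square_integrable unit_measure (\<lambda>x. complex_of_real (u x))"
proof -
  note [measurable] = assms(1)
  have "integrable unit_measure (\<lambda>x. (u x)\<^sup>2)"
  proof (rule integrable_bounded_unit[of _ "B\<^sup>2"])
    show "\<bar>(u x)\<^sup>2\<bar> \<le> B\<^sup>2" for x
      using power_mono[OF assms(2)[of x], of 2] by simp
  qed measurable
  then show ?thesis by (simp add: square_integrable_def)
qed

lemma bounded_kernel_averaging_mult:
  assumes [measurable]: "u \<in> borel_measurable unit_measure" "v \<in> borel_measurable unit_measure"
    and "\<And>x. \<bar>u x\<bar> \<le> B" "\<And>x. \<bar>v x\<bar> \<le> C"
  shows "bounded_kernel (\<lambda>(x, y). complex_of_real (u x * v y * averaging j x y))"
proof (rule bounded_kernelI[of _ "B * C * 2 ^ j"])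
  have B: "0 \<le> B" using assms(3)[of 0] by linarith
  have C: "0 \<le> C" using assms(4)[of 0] by linarith
  have "\<bar>u x * v y * averaging j x y\<bar> \<le> B * C * 2 ^ j" for x y
    unfolding abs_mult using assms(3,4) B C averaging_nonneg averaging_le by (intro mult_mono) auto
  then show "norm (case p of (x, y) \<Rightarrow> complex_of_real (u x * v y * averaging j x y)) \<le>
      B * C * 2 ^ j" for p
    by (cases p) (simp only: norm_of_real prod.case)
qed measurable

text \<open>Such a kernel is a finite sum of products, one for each cell.\<close>

lemma compact_HS_operator_averaging_mult:
  assumes [measurable]: "u \<in> borel_measurable unit_measure" "v \<in> borel_measurable unit_measure"
    and u: "\<And>x. \<bar>u x\<bar> \<le> B" and v: "\<And>x. \<bar>v x\<bar> \<le> C"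
  shows "HS_operator (\<lambda>(x, y). complex_of_real (u x * v y * averaging j x y)) \<in> compact_operators"
proof -
  have B: "0 \<le> B" using u[of 0] by linarith
  have C: "0 \<le> C" using v[of 0] by linarith
  define U where "U c x = u x * (2 ^ j * of_bool (dyadic_cell j x = c))" for c x
  define V where "V c y = v y * of_bool (dyadic_cell j y = c)" for c y
  have UV [measurable]: "U c \<in> borel_measurable unit_measure" "V c \<in>
      borel_measurable unit_measure" for c
    unfolding U_def V_def by measurable
  have U: "\<bar>U c x\<bar> \<le> B * 2 ^ j" for c x
    unfolding U_def abs_mult using u B by (intro mult_mono) auto
  have V: "\<bar>V c y\<bar> \<le> C" for c y
    using v[of y] C by (simp add: V_def)
  let ?k = "\<lambda>c (x, y). complex_of_real (U c x) * complex_of_real (V c y)"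
  have k: "bounded_kernel (?k c)" for c
  proof (rule bounded_kernelI[of _ "B * 2 ^ j * C"])
    show "norm (?k c p) \<le> B * 2 ^ j * C" for p
      using U V B C by (cases p) (auto simp: norm_mult intro!: mult_mono)
  qed measurable
  have sum: "HS_operator (\<lambda>p. \<Sum>c\<in>{0..2 ^ j}. ?k c p) \<in> compact_operators"
    using k U V
    by (intro compact_HS_operator_sum compact_HS_operator_rank_one square_integrable_bounded_unit
        square_integrable_bounded_kernel UV) auto
  have "HS_operator (\<lambda>(x, y). complex_of_real (u x * v y * averaging j x y)) =
      HS_operator (\<lambda>p. \<Sum>c\<in>{0..2 ^ j}. ?k c p)"
  proof (rule HS_operator_cong)
    show "AE p in square_measure. (case p of (x, y) \<Rightarrow>
        complex_of_real (u x * v y * averaging j x y)) = (\<Sum>c\<in>{0..2 ^ j}. ?k c p)"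
    proof (rule AE_I2)
      fix p assume "p \<in> space square_measure"
      then obtain x y where p: "p = (x, y)" and "x \<in> {0..1}" by (auto simp: space_square_measure)
      then have x: "dyadic_cell j x \<in> {0..2 ^ j}" by (intro dyadic_cell_unit)
      have "(\<Sum>c\<in>{0..2 ^ j}. U c x * V c y) = (\<Sum>c\<in>{0..2 ^ j}. if c =
          dyadic_cell j x then u x * v y * averaging j x y else 0)"
        by (intro sum.cong) (auto simp: U_def V_def averaging_def)
      also have "\<dots> = u x * v y * averaging j x y" using x by simp
      finally show "(case p of (x, y) \<Rightarrow> complex_of_real (u x * v y * averaging j x y)) =
          (\<Sum>c\<in>{0..2 ^ j}. ?k c p)"
        unfolding p prod.case of_real_mult[symmetric] of_real_sum[symmetric] by simp
    qed
  qed (intro square_integrable_bounded_kernel bounded_kernel_sum k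
      bounded_kernel_averaging_mult[OF assms])+
  with sum show ?thesis by simp
qed


section \<open>The paraproduct and its antisymmetrisation\<close>

text \<open>The kernel of \<open>\<Sum> r\<^sub>j E\<^sub>j\<close>, where \<open>E\<^sub>j\<close> is the conditional expectation of level \<open>j\<close> and \<open>r\<^sub>j\<close> is
  multiplication by the Rademacher function.\<close>

definition paraproduct_kernel :: "nat \<Rightarrow> real \<times> real \<Rightarrow> complex"
  where "paraproduct_kernel N = (\<lambda>(x, y). of_real (\<Sum>j<N. rademacher j y * averaging j x y))"

lemma bounded_paraproduct_kernel: "bounded_kernel (paraproduct_kernel N)"
proof -
  have "bounded_kernel (\<lambda>p. \<Sum>j<N. (case p of (x, y) \<Rightarrow>
      complex_of_real (1 * rademacher j y * averaging j x y)))"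
    by (intro bounded_kernel_sum bounded_kernel_averaging_mult[of _ _ 1 1]) (auto simp:
        abs_rademacher)
  then show ?thesis by (simp add: paraproduct_kernel_def split_beta')
qed

text \<open>The ranges of the summands \<open>r\<^sub>j E\<^sub>j\<close> are mutually orthogonal and \<open>r\<^sub>j\<close> is unitary, so the operator
  \<open>P\<close> satisfies \<open>P\<^sup>* P = \<Sum> E\<^sub>j\<close>, a sum of \<open>N\<close> contractions: the norm grows like the square root of \<open>N\<close>
  and not like \<open>N\<close>. In terms of kernels, orthogonality removes the off-diagonal terms of the double
  sum, and the Schur test bounds what remains.\<close>

lemma norm_paraproduct_operator: "norm (HS_operator (paraproduct_kernel N)) \<le> sqrt N"
proof -
  define q where "q = (\<lambda>(x, y). \<integral>z. paraproduct_kernel N (x, z) * cnj (paraproduct_kernel N (y, z))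
      \<partial>unit_measure)"
  have q: "q (x, y) = of_real (\<Sum>j<N. averaging j x y * (\<integral>z. averaging j x z \<partial>unit_measure))" for x y
  proof -
    have int: "integrable unit_measure (\<lambda>z. rademacher i z * averaging i x z * (rademacher j z *
        averaging j y z))" for i j
    proof (rule integrable_bounded_unit[of _ "2 ^ i * 2 ^ j"])
      show "\<bar>rademacher i z * averaging i x z * (rademacher j z * averaging j y z)\<bar> \<le>
          2 ^ i * 2 ^ j" for z
        unfolding abs_mult abs_rademacher using averaging_nonneg averaging_le
            by (simp add: mult_mono)
    qed measurable
    have paraproduct: "paraproduct_kernel N (x, z) * cnj (paraproduct_kernel N (y, z)) =
        of_real (\<Sum>i<N. \<Sum>j<N. rademacher i z * averaging i x z * (rademacher j z * averaging j
            y z))" for z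
      unfolding paraproduct_kernel_def prod.case complex_cnj_complex_of_real of_real_mult[symmetric]
          sum_product ..
    have "q (x, y) = of_real (\<integral>z. (\<Sum>i<N. \<Sum>j<N. rademacher i z * averaging i x z * (rademacher j z *
        averaging j y z)) \<partial>unit_measure)"
      unfolding q_def prod.case paraproduct integral_complex_of_real ..
    also have "\<dots> = of_real (\<Sum>i<N. \<Sum>j<N. \<integral>z. rademacher i z * averaging i x z * (rademacher j z *
        averaging j y z) \<partial>unit_measure)"
      using int by simp
    also have "\<dots> = of_real (\<Sum>i<N. \<Sum>j<N. if j =
        i then \<integral>z. rademacher i z * averaging i x z * (rademacher i z * averaging i y z)
        \<partial>unit_measure else 0)"
      by (intro arg_cong[where f = of_real] sum.cong refl) (use
          integral_rademacher_averaging_orthogonal in auto)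
    also have "\<dots> = of_real (\<Sum>i<N. \<integral>z. rademacher i z * averaging i x z * (rademacher i z * averaging
        i y z) \<partial>unit_measure)"
      by simp
    also have "\<dots> = of_real (\<Sum>j<N. averaging j x y * (\<integral>z. averaging j x z \<partial>unit_measure))"
    proof (intro arg_cong[where f = of_real] sum.cong refl)
      fix i
      have "rademacher i z * averaging i x z * (rademacher i z * averaging i y z) =
          averaging i x y * averaging i x z" for z
        by (auto simp: rademacher_def averaging_def)
      then show "(\<integral>z. rademacher i z * averaging i x z * (rademacher i z * averaging i y z)
          \<partial>unit_measure) =
          averaging i x y * (\<integral>z. averaging i x z \<partial>unit_measure)"
        by (simp only: integral_mult_right_zero)
    qed
    finally show ?thesis .
  qed
  have le: "norm (q (x, y)) \<le> (\<Sum>j<N. averaging j x y)" for x y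
  proof -
    have "0 \<le> averaging j x y * (\<integral>z. averaging j x z \<partial>unit_measure)"
      "averaging j x y * (\<integral>z. averaging j x z \<partial>unit_measure) \<le> averaging j x y" for j
      using averaging_nonneg[of j x y] integral_averaging_le'[of j x]
      by (auto intro!: mult_nonneg_nonneg integral_nonneg_AE mult_left_le simp: averaging_nonneg)
    then show ?thesis
      unfolding q norm_of_real by (subst abs_of_nonneg) (auto intro!: sum_nonneg sum_mono)
  qed
  have intx: "integrable unit_measure (\<lambda>x. averaging j x y)"
      and inty: "integrable unit_measure (\<lambda>y. averaging j x y)"
    for j x y
    by (auto intro!: integrable_bounded_unit[of _ "2 ^ j"] simp: averaging_nonneg averaging_le)
  have "norm (HS_operator q) \<le> N"
  proof (rule schur_test)
    show "bounded_kernel q"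
      using bounded_kernel_compose[OF bounded_kernel_adjoint[OF bounded_paraproduct_kernel]
          bounded_paraproduct_kernel]
      by (simp add: q_def)
    fix x :: real assume "x \<in> {0..1}"
    have "(\<integral>y. norm (q (x, y)) \<partial>unit_measure) \<le> (\<integral>y. (\<Sum>j<N. averaging j x y) \<partial>unit_measure)"
      by (rule integral_mono') (use inty le averaging_nonneg in \<open>auto intro: sum_nonneg\<close>)
    also have "\<dots> = (\<Sum>j<N. \<integral>y. averaging j x y \<partial>unit_measure)" using inty by simp
    also have "\<dots> \<le> (\<Sum>j<N. 1)" by (intro sum_mono integral_averaging_le')
    finally show "(\<integral>y. norm (q (x, y)) \<partial>unit_measure) \<le> N" by simp
  next
    fix y :: real assume "y \<in> {0..1}"
    have "(\<integral>x. norm (q (x, y)) \<partial>unit_measure) \<le> (\<integral>x. (\<Sum>j<N. averaging j x y) \<partial>unit_measure)"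
      by (rule integral_mono') (use intx le averaging_nonneg in \<open>auto intro: sum_nonneg\<close>)
    also have "\<dots> = (\<Sum>j<N. \<integral>x. averaging j x y \<partial>unit_measure)" using intx by simp
    also have "\<dots> \<le> (\<Sum>j<N. 1)" by (intro sum_mono integral_averaging_le)
    finally show "(\<integral>x. norm (q (x, y)) \<partial>unit_measure) \<le> N" by simp
  qed
  then have "(norm (HS_operator (paraproduct_kernel N)))\<^sup>2 \<le> N"
    using norm_HS_operator_power2_le[OF bounded_paraproduct_kernel, of N] by (simp add: q_def)
  then show ?thesis by (rule real_le_rsqrt)
qed

text \<open>The kernel of \<open>P - P\<^sup>*\<close> for the paraproduct \<open>P\<close>, that is, of \<open>\<Sum> (r\<^sub>j E\<^sub>j - E\<^sub>j r\<^sub>j)\<close>: a dyadic model of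
  \<open>1 / (y - x)\<close>, the kernel of the Hilbert transform.\<close>

definition antisymmetric_kernel :: "nat \<Rightarrow> real \<times> real \<Rightarrow> complex"
  where "antisymmetric_kernel N = (\<lambda>p. paraproduct_kernel N p + (-1) * (case p of (x, y) \<Rightarrow>
      cnj (paraproduct_kernel N (y, x))))"

lemma bounded_antisymmetric_kernel: "bounded_kernel (antisymmetric_kernel N)"
  unfolding antisymmetric_kernel_def
  by (intro bounded_kernel_add bounded_kernel_cmult bounded_kernel_adjoint
      bounded_paraproduct_kernel)

lemma antisymmetric_operator_eq: "HS_operator (antisymmetric_kernel N) =
    HS_operator (paraproduct_kernel N) + (-1) *\<^sub>C HS_operator (\<lambda>(x, y). cnj
        (paraproduct_kernel N (y, x)))"
proof -
  note s = square_integrable_bounded_kernel[OF bounded_kernel_adjoint[OF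
      bounded_paraproduct_kernel[of N]]]
  show ?thesis
    unfolding antisymmetric_kernel_def
    by (simp only: HS_operator_add[OF square_integrable_bounded_kernel[OF
        bounded_paraproduct_kernel] square_integrable_cmult[OF s]]
        HS_operator_scaleC[OF s])
qed

lemma norm_antisymmetric_operator: "norm (HS_operator (antisymmetric_kernel N)) \<le> 2 * sqrt N"
proof -
  have "norm (HS_operator (antisymmetric_kernel N)) \<le> norm (HS_operator (paraproduct_kernel N)) +
      norm (HS_operator (\<lambda>(x, y). cnj (paraproduct_kernel N (y, x))))"
    unfolding antisymmetric_operator_eq
    using norm_triangle_ineq[of "HS_operator (paraproduct_kernel N)"
        "(-1) *\<^sub>C HS_operator (\<lambda>(x, y). cnj (paraproduct_kernel N (y, x)))"]
    by (simp add: norm_scaleC)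
  also have "\<dots> \<le> sqrt N + sqrt N"
    using norm_paraproduct_operator norm_HS_operator_adjoint_le[OF bounded_paraproduct_kernel]
        by (intro add_mono) (auto intro: order_trans)
  finally show ?thesis by simp
qed

lemma compact_antisymmetric_operator: "HS_operator (antisymmetric_kernel N) \<in> compact_operators"
proof -
  have "HS_operator (\<lambda>p. \<Sum>j<N. case p of (x, y) \<Rightarrow>
      complex_of_real (1 * rademacher j y * averaging j x y)) \<in> compact_operators"
    "HS_operator (\<lambda>p. \<Sum>j<N. case p of (x, y) \<Rightarrow>
        complex_of_real (rademacher j x * 1 * averaging j x y)) \<in> compact_operators"
    by (intro compact_HS_operator_sum compact_HS_operator_averaging_mult[of _ _ 1 1]
        bounded_kernel_averaging_mult[of _ _ 1 1];
        simp add: abs_rademacher)+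
  moreover have "(\<lambda>p. \<Sum>j<N. case p of (x, y) \<Rightarrow>
      complex_of_real (1 * rademacher j y * averaging j x y)) = paraproduct_kernel N"
    by (simp add: fun_eq_iff paraproduct_kernel_def)
  moreover have "(\<lambda>p. \<Sum>j<N. case p of (x, y) \<Rightarrow>
      complex_of_real (rademacher j x * 1 * averaging j x y)) =
      (\<lambda>(x, y). cnj (paraproduct_kernel N (y, x)))"
    by (simp add: fun_eq_iff paraproduct_kernel_def averaging_sym)
  ultimately show ?thesis
    unfolding antisymmetric_operator_eq by (intro compact_operators_add
        compact_operators_scaleC) simp_all
qed


section \<open>The truncated kernels\<close>

text \<open>On a cell of level \<open>j\<close>, the weight \<open>(1 - r\<^sub>j(x)) (1 + r\<^sub>j(y))\<close> is \<open>4\<close> if \<open>x\<close> lies in the left and \<open>y\<close> in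
  the right half, and \<open>0\<close> otherwise.\<close>

definition triangular_kernel :: "nat \<Rightarrow> real \<times> real \<Rightarrow> complex"
  where "triangular_kernel N = (\<lambda>p. \<Sum>j<N. case p of (x, y) \<Rightarrow>
    of_real ((1 - rademacher j x) * (1 + rademacher j y) * averaging j x y))"

lemma bounded_triangular_kernel: "bounded_kernel (triangular_kernel N)"
  unfolding triangular_kernel_def
  by (intro bounded_kernel_sum bounded_kernel_averaging_mult[of _ _ 2 2]
      abs_one_plus_rademacher) measurable

lemma compact_triangular_operator: "HS_operator (triangular_kernel N) \<in> compact_operators"
  unfolding triangular_kernel_def
  by (intro compact_HS_operator_sum compact_HS_operator_averaging_mult[of _ _ 2 2]
      bounded_kernel_averaging_mult[of _ _ 2 2] abs_one_plus_rademacher) simp_all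

lemma norm_triangular_kernel_le: "norm (triangular_kernel N (x, y)) \<le> (\<Sum>j<N. 4 * averaging j x y)"
proof -
  have "\<bar>(1 - rademacher j x) * (1 + rademacher j y) * averaging j x y\<bar> \<le> 4 * averaging j x y" for j
    using mult_mono[OF abs_one_plus_rademacher(2)[of j x] abs_one_plus_rademacher(1)[of j y]]
        averaging_nonneg[of j x y]
    by (auto simp: abs_mult intro!: mult_right_mono)
  then show ?thesis
    unfolding triangular_kernel_def prod.case by (intro sum_norm_le) (simp only: norm_of_real)
qed

text \<open>The kernel is nonnegative and each level contributes at most \<open>4\<close> to its marginals. Unlike
  for the antisymmetric kernel there is no cancellation, and the growth is linear.\<close>

lemma norm_triangular_operator: "norm (HS_operator (triangular_kernel N)) \<le> 4 * N"
proof (rule schur_test[OF bounded_triangular_kernel])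
  fix x :: real
  have "(\<integral>y. norm (triangular_kernel N (x, y)) \<partial>unit_measure) \<le>
      (\<integral>y. (\<Sum>j<N. 4 * averaging j x y) \<partial>unit_measure)"
    using norm_triangular_kernel_le by (intro integral_mono') (auto simp: integrable_averaging
        averaging_nonneg intro!: sum_nonneg)
  also have "\<dots> = (\<Sum>j<N. 4 * (\<integral>y. averaging j x y \<partial>unit_measure))" 
    by (simp add: integrable_averaging)
  also have "\<dots> \<le> (\<Sum>j<N. 4 * 1)" by (intro sum_mono mult_left_mono integral_averaging_le') simp
  finally show "(\<integral>y. norm (triangular_kernel N (x, y)) \<partial>unit_measure) \<le> 4 * N" by simp
next
  fix y :: real
  have "(\<integral>x. norm (triangular_kernel N (x, y)) \<partial>unit_measure) \<le>
      (\<integral>x. (\<Sum>j<N. 4 * averaging j x y) \<partial>unit_measure)"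
    using norm_triangular_kernel_le by (intro integral_mono') (auto simp: integrable_averaging
        averaging_nonneg intro!: sum_nonneg)
  also have "\<dots> = (\<Sum>j<N. 4 * (\<integral>x. averaging j x y \<partial>unit_measure))" 
    by (simp add: integrable_averaging)
  also have "\<dots> \<le> (\<Sum>j<N. 4 * 1)" by (intro sum_mono mult_left_mono integral_averaging_le) simp
  finally show "(\<integral>x. norm (triangular_kernel N (x, y)) \<partial>unit_measure) \<le> 4 * N" by simp
qed

text \<open>Expanding the weight leaves the integral of the averaging kernel, which is \<open>1\<close>; each of the other
  terms has a Rademacher factor, and integrating it out first gives zero.\<close>

lemma integral_triangular_term:
  "(\<integral>y. (\<integral>x. (1 - rademacher j x) * (1 +
      rademacher j y) * averaging j x y \<partial>unit_measure) \<partial>unit_measure) = 1"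
proof -
  have rademacher_averaging: "integrable unit_measure (\<lambda>x. rademacher j x * averaging j x y)"
      "integrable unit_measure (\<lambda>y. rademacher j y * averaging j x y)" for x y
    by (auto intro!: integrable_bounded_unit[of _ "2 ^ j"] simp: abs_mult abs_rademacher
        averaging_nonneg averaging_le)
  have integrable: "integrable square_measure (\<lambda>(x, y). (1 -
      rademacher j x) * (rademacher j y * averaging j x y))"
  proof (rule unit_square.integrable_const_bound[of _ "2 * 2 ^ j"])
    have "\<bar>(1 - rademacher j x) * (rademacher j y * averaging j x y)\<bar> \<le> 2 * 2 ^ j" for x y
      unfolding abs_mult abs_rademacher using averaging_nonneg averaging_le abs_one_plus_rademacher
          by (simp add: mult_mono)
    then show "AE p in square_measure. norm (case p of (x, y) \<Rightarrow> (1 -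
        rademacher j x) * (rademacher j y * averaging j x y)) \<le> 2 * 2 ^ j"
      by auto
  qed measurable
  have 1: "(\<integral>x. (1 - rademacher j x) * averaging j x y \<partial>unit_measure) =
      (\<integral>x. averaging j x y \<partial>unit_measure)" for y
    using rademacher_averaging(1) by (simp add: left_diff_distrib integrable_averaging
        integral_rademacher_averaging)
  have 2: "(\<integral>y. (\<integral>x. (1 - rademacher j x) * (rademacher j y * averaging j x y) \<partial>unit_measure)
      \<partial>unit_measure) = 0"
  proof -
    have "(\<integral>y. rademacher j y * averaging j x y \<partial>unit_measure) = 0" for x
      using integral_rademacher_averaging[of j x] by (simp add: averaging_sym)
    then show ?thesis
      using unit_square.Fubini_integral[OF integrable] by simp
  qed
  have averaging1: "(\<integral>y. (\<integral>x. averaging j x y \<partial>unit_measure) \<partial>unit_measure) = 1"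
  proof -
    have "(\<integral>y. (\<integral>x. averaging j x y \<partial>unit_measure) \<partial>unit_measure) = (\<integral>y. 1 \<partial>unit_measure)"
    proof (rule integral_cong_AE)
      show "AE y in unit_measure. (\<integral>x. averaging j x y \<partial>unit_measure) = 1"
        using AE_unit_neq[of 1] AE_space
      proof eventually_elim
        case (elim y)
        then have y: "0 \<le> y" "y < 1" by (auto simp: space_restrict_space)
        then have "2 ^ j * y < 2 ^ j * 1" by (intro mult_strict_left_mono) auto
        then have "dyadic_cell j y < 2 ^ j" by (simp add: dyadic_cell_def floor_less_iff)
        moreover have "0 \<le> dyadic_cell j y" using y by (simp add: dyadic_cell_def)
        ultimately show ?case by (simp add: integral_averaging)
      qed
    qed measurable
    then show ?thesis by (simp add: measure_restrict_space space_restrict_space)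
  qed
  have "(\<integral>y. (\<integral>x. (1 - rademacher j x) * (1 +
      rademacher j y) * averaging j x y \<partial>unit_measure) \<partial>unit_measure) =
    (\<integral>y. (\<integral>x. averaging j x y \<partial>unit_measure) + (\<integral>x. (1 - rademacher j x) * (rademacher j y *
        averaging j x y) \<partial>unit_measure) \<partial>unit_measure)"
  proof (intro Bochner_Integration.integral_cong refl)
    fix y
    have i: "integrable unit_measure (\<lambda>x. (1 - rademacher j x) * (c * averaging j x y))"
        if "\<bar>c\<bar> \<le> 1" for c
    proof (rule integrable_bounded_unit[of _ "2 * (1 * 2 ^ j)"])
      show "\<bar>(1 - rademacher j x) * (c * averaging j x y)\<bar> \<le> 2 * (1 * 2 ^ j)" for x
        unfolding abs_mult using averaging_nonneg averaging_le abs_one_plus_rademacher that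
            by (intro mult_mono) auto
    qed measurable
    have "(\<integral>x. (1 - rademacher j x) * (1 + rademacher j y) * averaging j x y \<partial>unit_measure) =
        (\<integral>x. (1 - rademacher j x) * (1 * averaging j x y) + (1 - rademacher j x) * (rademacher j y *
            averaging j x y) \<partial>unit_measure)"
      by (intro Bochner_Integration.integral_cong) (auto simp: algebra_simps)
    also have "\<dots> = (\<integral>x. (1 - rademacher j x) * (1 * averaging j x y) \<partial>unit_measure) +
        (\<integral>x. (1 - rademacher j x) * (rademacher j y * averaging j x y) \<partial>unit_measure)"
      by (intro Bochner_Integration.integral_add i) (auto simp: abs_rademacher)
    finally show "(\<integral>x. (1 - rademacher j x) * (1 +
        rademacher j y) * averaging j x y \<partial>unit_measure) =
        (\<integral>x. averaging j x y \<partial>unit_measure) + (\<integral>x. (1 - rademacher j x) * (rademacher j y *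
            averaging j x y) \<partial>unit_measure)"
      by (simp add: 1)
  qed
  also have "\<dots> = 1"
  proof (subst Bochner_Integration.integral_add)
    show "integrable unit_measure (\<lambda>y. \<integral>x. (1 -
        rademacher j x) * (rademacher j y * averaging j x y) \<partial>unit_measure)"
      using unit_square.integrable_snd[OF integrable] by simp
    show "integrable unit_measure (\<lambda>y. \<integral>x. averaging j x y \<partial>unit_measure)"
      by (rule integrable_bounded_unit[of _ 1]) (simp_all add: integral_averaging)
  qed (simp add: averaging1 2)
  finally show ?thesis .
qed

definition mean :: "L2 \<Rightarrow> complex"
  where "mean f = (\<integral>x. rep_L2 f x \<partial>unit_measure)"

lemma mean_add: "mean (f + g) = mean f + mean g"
proof -
  have "mean (f + g) = (\<integral>x. rep_L2 f x + rep_L2 g x \<partial>unit_measure)"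
    unfolding mean_def using AE_rep_add[of f g] by (intro integral_cong_AE) measurable
  then show ?thesis by (simp add: mean_def integrable_rep)
qed

lemma mean_scaleC: "mean (c *\<^sub>C f) = c * mean f"
proof -
  have "mean (c *\<^sub>C f) = (\<integral>x. c * rep_L2 f x \<partial>unit_measure)"
    unfolding mean_def using AE_rep_scaleC[of c f] by (intro integral_cong_AE) measurable
  then show ?thesis by (simp add: mean_def)
qed

lemma norm_mean_le: "norm (mean f) \<le> norm f"
proof -
  have "square_integrable unit_measure (\<lambda>x. 1)" by (simp add: square_integrable_def)
  from HS_pointwise(2)[OF this square_integrable_rep, of f] have "(norm (mean f))\<^sup>2 \<le> (norm f)\<^sup>2"
    by (simp add: mean_def power2_norm_L2 measure_restrict_space space_restrict_space)
  then show ?thesis by (rule power2_le_imp_le) simp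
qed

definition one_L2 :: L2
  where "one_L2 = abs_L2 (\<lambda>x. 1)"

text \<open>The functional \<open>T \<mapsto> \<langle>T 1, 1\<rangle>\<close> will detect nonzero weak* limits.\<close>

lemma mean_one_in_dual: 
  "(\<lambda>T\<in>compact_operators. mean (blinfun_apply T one_L2)) \<in> dual compact_operators"
proof -
  have "norm (mean (blinfun_apply T one_L2)) \<le> norm one_L2 * norm T" for T
    using norm_mean_le[of "T one_L2"] norm_blinfun[of T one_L2] by (simp add: mult.commute)
  then have "\<exists>B. \<forall>T\<in>compact_operators. norm (mean (blinfun_apply T one_L2)) \<le> B * norm T"
    by blast
  then show ?thesis
    by (simp add: dual_def compact_operators_add compact_operators_scaleC blinfun.add_left
        scaleC_blinfun.rep_eq mean_add mean_scaleC)
qed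

lemma AE_rep_one: "AE x in unit_measure. rep_L2 one_L2 x = 1"
  unfolding one_L2_def by (rule AE_rep_abs) (simp add: square_integrable_def)

lemma mean_HS_operator_one:
  assumes k: "square_integrable square_measure k"
  shows "mean (HS_operator k one_L2) = (\<integral>y. (\<integral>x. k (x, y) \<partial>unit_measure) \<partial>unit_measure)"
proof -
  note [measurable] = square_integrable_measurable[OF k]
  show ?thesis
    unfolding mean_def HS_operator_apply[OF k]
  proof (rule integral_cong_AE)
    show "AE y in unit_measure. rep_L2 (integral_transform k one_L2) y =
        (\<integral>x. k (x, y) \<partial>unit_measure)"
      using AE_integral_transform[OF k, of one_L2] AE_space
    proof eventually_elim
      case (elim y)
      have [measurable]: "(\<lambda>x. k (x, y)) \<in> borel_measurable unit_measure"
        using elim(2) by measurable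
      have "(\<integral>x. k (x, y) * rep_L2 one_L2 x \<partial>unit_measure) = (\<integral>x. k (x, y) \<partial>unit_measure)"
        using AE_rep_one by (intro integral_cong_AE) (measurable, auto)
      then show ?case using elim(1) by simp
    qed
  qed measurable
qed

lemma mean_triangular_operator: "mean (HS_operator (triangular_kernel N) one_L2) = N"
proof -
  let ?t = "\<lambda>j x y. (1 - rademacher j x) * (1 + rademacher j y) * averaging j x y"
  have ix: "integrable unit_measure (\<lambda>x. ?t j x y)" for j y
  proof (rule integrable_bounded_unit[of _ "2 * 2 * 2 ^ j"])
    show "\<bar>?t j x y\<bar> \<le> 2 * 2 * 2 ^ j" for x
      unfolding abs_mult using averaging_nonneg averaging_le abs_one_plus_rademacher
          by (intro mult_mono) auto
  qed measurable
  have "integrable square_measure (\<lambda>(x, y). ?t j x y)" for j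
  proof (rule unit_square.integrable_const_bound[of _ "2 * 2 * 2 ^ j"])
    have "\<bar>?t j x y\<bar> \<le> 2 * 2 * 2 ^ j" for x y
      unfolding abs_mult using averaging_nonneg averaging_le abs_one_plus_rademacher
          by (intro mult_mono) auto
    then show "AE p in square_measure. norm (case p of (x, y) \<Rightarrow> ?t j x y) \<le> 2 * 2 * 2 ^ j"
      by (intro AE_I2) (auto simp del: abs_mult)
  qed measurable
  then have iy: "integrable unit_measure (\<lambda>y. \<integral>x. ?t j x y \<partial>unit_measure)" for j
    using unit_square.integrable_snd by fastforce
  have "triangular_kernel N (x, y) = of_real (\<Sum>j<N. ?t j x y)" for x y
    by (simp only: triangular_kernel_def prod.case of_real_sum)
  then have "mean (HS_operator (triangular_kernel N) one_L2) =
      of_real (\<integral>y. (\<integral>x. (\<Sum>j<N. ?t j x y) \<partial>unit_measure) \<partial>unit_measure)"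
    by (simp only: mean_HS_operator_one[OF square_integrable_bounded_kernel[OF
        bounded_triangular_kernel]]
        integral_complex_of_real)
  also have "(\<integral>y. (\<integral>x. (\<Sum>j<N. ?t j x y) \<partial>unit_measure) \<partial>unit_measure) =
      (\<Sum>j<N. \<integral>y. (\<integral>x. ?t j x y \<partial>unit_measure) \<partial>unit_measure)"
    by (simp only: Bochner_Integration.integral_sum ix iy)
  also have "\<dots> = N"
    by (simp only: integral_triangular_term) simp
  finally show ?thesis by simp
qed

text \<open>If \<open>x\<close> and \<open>y\<close> lie in the same cell but in different halves, then the order of the halves is the
  order of \<open>x\<close> and \<open>y\<close>; if they lie in the same half, the difference of Rademacher values vanishes.\<close>

lemma triangular_part_antisymmetric_kernel:
  assumes "x \<in> {0..1}" "y \<in> {0..1}" and \<phi>: "\<phi> = indicator {(x, y). x \<in> {0..1} \<and> y \<in> {0..1} \<and> x < y}"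
  shows "\<phi> (x, y) * antisymmetric_kernel N (x, y) = triangular_kernel N (x, y) / 2"
proof -
  have "indicator {(x, y). x \<in> {0..1} \<and> y \<in> {0..1} \<and>
      x < y} (x, y) * ((rademacher j y - rademacher j x) * averaging j x y) =
      (1 - rademacher j x) * (1 + rademacher j y) * averaging j x y / 2" for j
  proof (cases "dyadic_cell j x = dyadic_cell j y")
    case True
    have mono: "dyadic_cell (Suc j) a \<le> dyadic_cell (Suc j) b" if "a \<le> b" for a b
      unfolding dyadic_cell_def using that by (intro floor_mono mult_left_mono) auto
    have div: "dyadic_cell (Suc j) x div 2 = dyadic_cell (Suc j) y div 2"
      using True by (simp only: dyadic_cell_Suc_div_2)
    have left: "x < y" if "even (dyadic_cell (Suc j) x)" "odd (dyadic_cell (Suc j) y)"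
    proof (rule ccontr)
      assume "\<not> x < y"
      then have "dyadic_cell (Suc j) y \<le> dyadic_cell (Suc j) x" by (intro mono) simp
      with div that show False by presburger
    qed
    have right: "\<not> x < y" if "odd (dyadic_cell (Suc j) x)" "even (dyadic_cell (Suc j) y)"
    proof
      assume "x < y"
      then have "dyadic_cell (Suc j) x \<le> dyadic_cell (Suc j) y" by (intro mono) simp
      with div that show False by presburger
    qed
    from left right show ?thesis
      using assms(1,2) by (auto simp: rademacher_def)
  qed (simp add: averaging_def)
  then have "(\<Sum>j<N. indicator {(x, y). x \<in> {0..1} \<and> y \<in> {0..1} \<and>
      x < y} (x, y) * ((rademacher j y - rademacher j x) * averaging j x y)) =
      (\<Sum>j<N. (1 - rademacher j x) * (1 + rademacher j y) * averaging j x y / 2)"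
    by (simp only:)
  then have *: "indicator {(x, y). x \<in> {0..1} \<and> y \<in> {0..1} \<and>
      x < y} (x, y) * (\<Sum>j<N. (rademacher j y - rademacher j x) * averaging j x y) =
      (\<Sum>j<N. (1 - rademacher j x) * (1 + rademacher j y) * averaging j x y) / 2"
    by (simp only: sum_distrib_left sum_divide_distrib)
  have "antisymmetric_kernel N (x, y) = of_real (\<Sum>j<N. (rademacher j y -
      rademacher j x) * averaging j x y)"
    by (simp add: antisymmetric_kernel_def paraproduct_kernel_def left_diff_distrib sum_subtractf
        averaging_sym[of _ y x]
        flip: of_real_mult of_real_sum of_real_diff)
  moreover have "\<phi> (x, y) = of_real (indicator {(x, y). x \<in> {0..1} \<and> y \<in> {0..1} \<and> x < y} (x, y))"
    by (simp add: \<phi> indicator_def)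
  moreover have "triangular_kernel N (x, y) =
      of_real (\<Sum>j<N. (1 - rademacher j x) * (1 + rademacher j y) * averaging j x y)"
    by (simp only: triangular_kernel_def prod.case of_real_sum)
  ultimately show ?thesis
    by (simp only: * of_real_mult[symmetric] of_real_divide of_real_numeral)
qed


section \<open>Failure of weak* closability\<close>

text \<open>Dividing the antisymmetric kernels by \<open>N\<close> gives operators of norm \<open>O(N\<^sup>-\<^sup>1\<^sup>/\<^sup>2)\<close>, whereas their
  truncations stay bounded and keep a constant value of the functional \<open>T \<mapsto> \<langle>T 1, 1\<rangle>\<close>, namely
  \<open>1/4\<close>.\<close>

lemma not_weak_star_closable_triangular_truncation:
  assumes \<phi>: "\<phi> = indicator {(x, y). x \<in> {0..1} \<and> y \<in> {0..1} \<and> x < y}"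
  shows "\<not> weak_star_closable_multiplier \<phi>"
proof -
  \<comment> \<open>The numbers of levels start at \<open>1\<close>, so that the quotients are proper.\<close>
  define k where "k n = (\<lambda>p. complex_of_real (1 / (2 * real (Suc n))) * antisymmetric_kernel (Suc
      n) p)" for n
  define l where "l n = (\<lambda>p. complex_of_real (1 / (4 * real (Suc n))) * triangular_kernel (Suc
      n) p)" for n
  note sa = square_integrable_bounded_kernel[OF bounded_antisymmetric_kernel]
  note st = square_integrable_bounded_kernel[OF bounded_triangular_kernel]
  have sk: "square_integrable square_measure (k n)"
      and sl: "square_integrable square_measure (l n)" for n
    unfolding k_def l_def by (intro square_integrable_cmult sa st)+
  have \<phi>k: "\<phi> p * k n p = l n p" if "p \<in> space square_measure" for p n
  proof -
    obtain x y where p: "p = (x, y)" "x \<in> {0..1}" "y \<in> {0..1}"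
      using \<open>p \<in> space square_measure\<close> by (auto simp: space_square_measure)
    have "\<phi> p * k n p = complex_of_real (1 / (2 * real (Suc n))) * (\<phi> (x, y) * antisymmetric_kernel
        (Suc n) (x, y))"
      by (simp add: k_def p(1))
    also have "\<dots> = l n p"
      unfolding triangular_part_antisymmetric_kernel[OF p(2,3) \<phi>] by (simp add: l_def p(1))
    finally show ?thesis .
  qed
  have s\<phi>k: "square_integrable square_measure (\<lambda>p. \<phi> p * k n p)" for n
    using sl[of n] by (rule square_integrable_cong) (simp add: \<phi>k)
  have Hk: "HS_operator (k n) = complex_of_real (1 / (2 * real (Suc n))) *\<^sub>C HS_operator
      (antisymmetric_kernel (Suc n))" for n
    unfolding k_def by (rule HS_operator_scaleC[OF sa])
  have Hl: "HS_operator (l n) = complex_of_real (1 / (4 * real (Suc n))) *\<^sub>C HS_operator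
      (triangular_kernel (Suc n))" for n
    unfolding l_def by (rule HS_operator_scaleC[OF st])
  have "HS_operator (\<lambda>p. \<phi> p * k n p) = HS_operator (l n)" for n
    by (rule HS_operator_cong[OF s\<phi>k sl]) (simp add: \<phi>k)
  then have G: "(HS_operator (k n), HS_operator (l n)) \<in> multiplier_graph \<phi>" for n
    unfolding multiplier_graph_def multiplier_domain_def using sk s\<phi>k by force
  have zero: "(0, 0) \<in> multiplier_graph \<phi>"
    unfolding multiplier_graph_def multiplier_domain_def
    using HS_operator_zero square_integrable_zero by force
  have k_bound: "norm (HS_operator (k n)) \<le> 1 / sqrt (Suc n)" for n
  proof -
    have "norm (HS_operator (k n)) \<le> 1 / (2 * real (Suc n)) * (2 * sqrt (Suc n))"
      unfolding Hk norm_scaleC norm_of_real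
      using norm_antisymmetric_operator[of "Suc n"] by (intro mult_mono) auto
    also have "\<dots> = 1 / sqrt (Suc n)"
      by (simp add: field_simps flip: real_sqrt_mult)
    finally show ?thesis .
  qed
  have "(\<lambda>n. 1 / sqrt (Suc n)) \<longlonglongrightarrow> 0"
    using tendsto_real_sqrt[OF LIMSEQ_inverse_real_of_nat]
        by (simp add: real_sqrt_inverse divide_inverse)
  then have lim: "(\<lambda>n. HS_operator (k n)) \<longlonglongrightarrow> 0"
    by (rule Lim_null_comparison[OF always_eventually[OF allI[OF k_bound]]])
  have bound: "norm (HS_operator (l n)) \<le> 1" for n
  proof -
    have "norm (HS_operator (l n)) \<le> 1 / (4 * real (Suc n)) * (4 * real (Suc n))"
      unfolding Hl norm_scaleC norm_of_real
      using norm_triangular_operator[of "Suc n"] by (intro mult_mono) auto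
    then show ?thesis by simp
  qed
  have lower: "1 / 4 \<le> norm (restrict (\<lambda>T. mean (blinfun_apply T one_L2)) compact_operators
      (HS_operator (l n)))" for n
  proof -
    have mem: "HS_operator (l n) \<in> compact_operators"
      unfolding Hl by (intro compact_operators_scaleC compact_triangular_operator)
    have "mean (blinfun_apply (HS_operator (l n)) one_L2) =
        complex_of_real (1 / (4 * real (Suc n))) * of_nat (Suc n)"
      by (simp only: Hl scaleC_blinfun.rep_eq mean_scaleC mean_triangular_operator)
    also have "\<dots> = complex_of_real (1 / (4 * real (Suc n)) * real (Suc n))"
        by (simp only: of_real_mult of_real_of_nat_eq)
    also have "1 / (4 * real (Suc n)) * real (Suc n) = 1 / 4" by (simp add: field_simps)
    finally show ?thesis
      by (simp only: restrict_apply'[OF mem] norm_of_real)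
  qed
  show ?thesis
    unfolding weak_star_closable_multiplier_def
  proof (rule compact_operators.not_weak_star_closableI[OF G zero _ _ lim bound
      mean_one_in_dual _ lower])
    show "HS_operator (k n) \<in> compact_operators" for n
      unfolding Hk by (intro compact_operators_scaleC compact_antisymmetric_operator)
    show "HS_operator (l n) \<in> compact_operators" for n
      unfolding Hl by (intro compact_operators_scaleC compact_triangular_operator)
  qed simp
qed

theorem proposition5p9:
  fixes \<Delta> :: "(real \<times> real) set" and \<phi> :: "real \<times> real \<Rightarrow> complex"
  assumes "\<Delta> = {(x, y). x \<in> {0..1} \<and> y \<in> {0..1} \<and> x < y}"
    and "\<phi> = indicator \<Delta>"
  shows "closable_multiplier \<phi> \<and> \<not> weak_star_closable_multiplier \<phi>"
  using closable_triangular_truncation not_weak_star_closable_triangular_truncation assms by simp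

end
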